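(* Let $K>0$ and $d_0\ge 0$. Assume that the area-constrained variational problem: minimize $J_b(a,d,u)$ over $b\ge a$, $d(a)\in[0,d_0]$ and measurable $u:[a,b]\to[0,1]$ with $d'(t)=u(t)$, subject to the area constraint (all defined in the context), admits an optimal pair $(d^{opt},b^* )$ such that $d^{opt}$ is Lipschitz with constant $u^*=1$ on $[a,b^*]$, non-decreasing, with $t\mapsto t-d^{opt}(t)$ non-decreasing. Let $u^{opt}=(d^{opt})'$. (1) There exist a constant $r$ and a costate $p$ on $[a,b^*]$ satisfying $$p'(t)=\partial_2\Big(\nu_q+\frac{\partial_1\nu_q+\partial_2\nu_q}{\nu_q}\Big)(t,t-d^{opt}(t))-\partial_2\Big[\frac{\partial_2\nu_q}{\nu_q}\Big](t,t-d^{opt}(t))\,u^{opt}(t)-r,$$ such that $d^{opt}$ can have only the following three behaviours on subintervals of $[a,b^*]$: (i) on an interval $[\alpha_1,\beta_1]$ with $u^{opt}=0$, $d^{opt}(t)=d^{opt}(\alpha_1)$ is constant and, for $t\in(\alpha_1,\beta_1)$, $$p(t)=p(\alpha_1)+\int_{\alpha_1}^t \partial_2\Big(\nu_q+\frac{\partial_1\nu_q+\partial_2\nu_q}{\nu_q}\Big)(s,s-d^{opt}(\alpha_1))\,ds-r(t-\alpha_1)>\frac{\partial_2\nu_q}{\nu_q}(t,t-d^{opt}(\alpha_1));$$ (ii) on an interval on which $p(t)=\frac{\partial_2\nu_q}{\nu_q}(t,t-d^{opt}(t))$, the structure equation $$\partial_2\nu_q(t,t-d^{opt}(t))=r$$ holds;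 (iii) on an interval $(\alpha_3,\beta_3)$ with $u^{opt}=1$, $d^{opt}(t)=d^{opt}(\alpha_3)+(t-\alpha_3)$ and, writing $c=\alpha_3-d^{opt}(\alpha_3)$, $$p(t)=p(\alpha_3)+\int_{\alpha_3}^t\partial_2\nu_q(s,c)\,ds+\frac{\partial_2\nu_q}{\nu_q}(t,c)-\frac{\partial_2\nu_q}{\nu_q}(\alpha_3,c)-r(t-\alpha_3)\le\frac{\partial_2\nu_q}{\nu_q}(t,c).$$ Moreover $b^*$ is determined from the transversality conditions $$H^+(b^* )=0,\qquad p(b^* )=0,$$ to which one adds the area saturation $\int_a^{b^*}d^{opt}(t)\,dt=K$. (2) In the absence of the area constraint, the structure equation in (ii) holds with $r=0$, i.e. $\partial_2\nu_q(t,t-d^{opt}(t))=0$.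
   Context: $X$ is a time-homogeneous spectrally negative (no positive jumps) strong Markov process, $q>0$ a discount rate, $T_{b,+}$ and $T_{y,-}$ the first passage times of $X$ above $b$ and below $y$, and $$\nu_q(x,y):=\lim_{\varepsilon\downarrow0}\frac{1-E_x\big[e^{-qT_{x+\varepsilon,+}};\,T_{x+\varepsilon,+}<T_{y,-}\big]}{\varepsilon},$$ which is assumed to exist, to be positive and to be of class $C^2$. $\partial_1,\partial_2$ denote partial derivatives of $\nu_q$ (and of expressions built from it) with respect to its first and second variable. Fix $a\ge0$. For $b\ge a$, a measurable control $u:[a,b]\to[0,1]$ and $d'(t)=u(t)$ with initial value $d(a)\in[0,d_0]$, the cost is $$J_b(a,d,u)=\int_a^b\Big(\nu_q(t,t-d(t))+\frac{\partial_1\nu_q(t,t-d(t))+\partial_2\nu_q(t,t-d(t))(1-u(t))}{\nu_q(t,t-d(t))}\Big)dt+\log\nu_q(a,a-d(a)),$$ which equals $\int_a^b\nu_q(t,t-d(t))\,dt+\log\nu_q(b,b-d(b))$ (minus the logarithm of the expected discounted dividends paid at barrier $b$ until the draw-down time $\inf\{t: X_t<\overline X_t-d(\overline X_t)\}$, $\overline X$ being the running maximum). One minimizes over $b\ge a$ (free), $u$ and the initial value; $d(b)$ is free. The original area constraint is $\int_a^b d(t)\,dt\le K$; the area-constrained problem is treated in its saturated form, with the additional state $e'(t)=d(t)$, $e(a)=0$, $e(b)=K$. The extended Hamiltonian (to be minimized in $u\in[0,1]$) is $$H^+(t,d,e,u,p,r)=\nu_q(t,t-d)+\frac{\partial_1\nu_q(t,t-d)+\partial_2\nu_q(t,t-d)}{\nu_q(t,t-d)}+\Big(p-\frac{\partial_2\nu_q(t,t-d)}{\nu_q(t,t-d)}\Big)u+rd,$$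 where $p,r$ are the costates associated with $d,e$ by Pontryagin's principle: $r'=-\partial_eH^+=0$, $p'=-\partial_dH^+$ along the optimal trajectory, and $u^{opt}(t)$ minimizes $u\mapsto H^+(t,d^{opt}(t),e^{opt}(t),u,p(t),r)$ over $[0,1]$ for a.e. $t$. $H^+(b^* )$ denotes the (minimal in $u$) value of $H^+$ along the optimal trajectory at $t=b^*$. The intervals in (i), (ii), (iii) correspond respectively to a positive, zero and non-positive (with $u^{opt}=1$) coefficient of $u$ in $H^+$. The problem without area constraint is the same one with the constraint dropped (and Hamiltonian $H^+$ with $r=0$). *)

theory Defs
  imports "HOL-Probability.Probability"
begin

text \<open>
  A time-homogeneous strong Markov process on the real line with right-continuous paths, left limits
  and no positive jumps. It has infinite lifetime, \<open>P x\<close> is its law when started at \<open>x\<close>, and only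
  times \<open>t \<ge> 0\<close> matter. It suffices to impose the strong Markov property at finite
  stopping times: a general \<open>T\<close> is reached through \<open>min T n\<close> and the events \<open>T \<le> n\<close>.
\<close>

locale spectrally_negative_strong_markov = filtration "space M" F
  for M :: "'w measure" and F :: "real \<Rightarrow> 'w measure" +
  fixes P :: "real \<Rightarrow> 'w measure" and X :: "real \<Rightarrow> 'w \<Rightarrow> real"
  assumes sets_F_subset: "\<And>t. sets (F t) \<subseteq> sets M"
    and kernel: "P \<in> borel \<rightarrow>\<^sub>M prob_algebra M"
    and adapted: "\<And>t. t \<ge> 0 \<Longrightarrow> X t \<in> borel_measurable (F t)"
    and initial: "\<And>x. AE \<omega> in P x. X 0 \<omega> = x"
    and right_continuous:
      "\<And>\<omega> t. \<omega> \<in> space M \<Longrightarrow> t \<ge> 0 \<Longrightarrow> ((\<lambda>s. X s \<omega>) \<longlongrightarrow> X t \<omega>) (at_right t)"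
    and no_positive_jumps:
      "\<And>\<omega> t. \<omega> \<in> space M \<Longrightarrow> t > 0 \<Longrightarrow> \<exists>l. ((\<lambda>s. X s \<omega>) \<longlongrightarrow> l) (at_left t) \<and> X t \<omega> \<le> l"
    and strong_markov:
      "\<And>x T A s B. stopping_time F T \<Longrightarrow> (\<And>\<omega>. \<omega> \<in> space M \<Longrightarrow> T \<omega> \<ge> 0) \<Longrightarrow> A \<in> sets (pre_sigma T)
        \<Longrightarrow> s \<ge> 0 \<Longrightarrow> B \<in> sets (borel :: real measure)
        \<Longrightarrow> measure (P x) {\<omega> \<in> A. X (T \<omega> + s) \<omega> \<in> B} =
            (LINT \<omega>:A|P x. measure (P (X (T \<omega>) \<omega>)) {\<omega>' \<in> space M. X s \<omega>' \<in> B})"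

text \<open>
  Both passages are strict. In particular started at \<open>y\<close> the process need not pass below \<open>y\<close>
  immediately, so that \<open>\<nu>\<^sub>q(y, y)\<close> can be finite (paths of bounded variation).
\<close>

definition passage_above :: "(real \<Rightarrow> 'w \<Rightarrow> real) \<Rightarrow> real \<Rightarrow> 'w \<Rightarrow> ereal" where
  "passage_above X b \<omega> = (INF t\<in>{t. 0 \<le> t \<and> b < X t \<omega>}. ereal t)"

definition passage_below :: "(real \<Rightarrow> 'w \<Rightarrow> real) \<Rightarrow> real \<Rightarrow> 'w \<Rightarrow> ereal" where
  "passage_below X y \<omega> = (INF t\<in>{t. 0 \<le> t \<and> X t \<omega> < y}. ereal t)"

definition discounted_passage ::
    "(real \<Rightarrow> 'w measure) \<Rightarrow> (real \<Rightarrow> 'w \<Rightarrow> real) \<Rightarrow> real \<Rightarrow> real \<Rightarrow> real \<Rightarrow> real \<Rightarrow> real" where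
  "discounted_passage P X q x b y =
     (LINT \<omega>:{\<omega> \<in> space (P x). passage_above X b \<omega> < passage_below X y \<omega>}|P x.
        exp (- q * real_of_ereal (passage_above X b \<omega>)))"

definition is_nu ::
    "(real \<Rightarrow> 'w measure) \<Rightarrow> (real \<Rightarrow> 'w \<Rightarrow> real) \<Rightarrow> real \<Rightarrow> (real \<times> real) set \<Rightarrow> (real \<Rightarrow> real \<Rightarrow> real) \<Rightarrow> bool"
where
  "is_nu P X q D v \<longleftrightarrow> (\<forall>(x, y)\<in>D.
     ((\<lambda>\<epsilon>. (1 - discounted_passage P X q x (x + \<epsilon>) y) / \<epsilon>) \<longlongrightarrow> v x y) (at_right 0))"

text \<open>
  Derivatives are taken within \<open>D\<close>, so that they are one-sided at points of the diagonal when
  the diagonal belongs to \<open>D\<close>.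
\<close>

definition pd1 :: "(real \<times> real) set \<Rightarrow> (real \<Rightarrow> real \<Rightarrow> real) \<Rightarrow> real \<Rightarrow> real \<Rightarrow> real" where
  "pd1 D f x y = vector_derivative (\<lambda>s. f s y) (at x within {s. (s, y) \<in> D})"

definition pd2 :: "(real \<times> real) set \<Rightarrow> (real \<Rightarrow> real \<Rightarrow> real) \<Rightarrow> real \<Rightarrow> real \<Rightarrow> real" where
  "pd2 D f x y = vector_derivative (\<lambda>s. f x s) (at y within {s. (x, s) \<in> D})"

primrec Ck_on :: "nat \<Rightarrow> (real \<times> real) set \<Rightarrow> (real \<Rightarrow> real \<Rightarrow> real) \<Rightarrow> bool" where
  "Ck_on 0 D f \<longleftrightarrow> continuous_on D (\<lambda>(x, y). f x y)"
| "Ck_on (Suc k) D f \<longleftrightarrow>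
     (\<lambda>(x, y). f x y) differentiable_on D \<and> Ck_on k D (pd1 D f) \<and> Ck_on k D (pd2 D f)"

definition running :: "(real \<times> real) set \<Rightarrow> (real \<Rightarrow> real \<Rightarrow> real) \<Rightarrow> real \<Rightarrow> real \<Rightarrow> real" where
  "running D v x y = v x y + (pd1 D v x y + pd2 D v x y) / v x y"

definition logd2 :: "(real \<times> real) set \<Rightarrow> (real \<Rightarrow> real \<Rightarrow> real) \<Rightarrow> real \<Rightarrow> real \<Rightarrow> real" where
  "logd2 D v x y = pd2 D v x y / v x y"

text \<open>
  \<open>d' = u\<close> is understood in the sense of Caratheodory: \<open>d\<close> is the indefinite integral of the
  measurable control \<open>u\<close>. The last condition says that the cost is defined along \<open>d\<close>; it
  is automatic if \<open>D\<close> is the closed half-plane \<open>{(x, y). y \<le> x}\<close>, because \<open>d \<ge> 0\<close>.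
\<close>

definition admissible ::
    "(real \<times> real) set \<Rightarrow> real \<Rightarrow> real \<Rightarrow> real \<Rightarrow> (real \<Rightarrow> real) \<Rightarrow> (real \<Rightarrow> real) \<Rightarrow> bool" where
  "admissible D a d0 b d u \<longleftrightarrow>
     a \<le> b \<and> u \<in> borel_measurable (lebesgue_on {a..b}) \<and> (\<forall>t\<in>{a..b}. u t \<in> {0..1}) \<and>
     d a \<in> {0..d0} \<and> (\<forall>t\<in>{a..b}. (u has_integral (d t - d a)) {a..t}) \<and>
     (\<forall>t\<in>{a..b}. (t, t - d t) \<in> D)"

definition cost ::
    "(real \<times> real) set \<Rightarrow> (real \<Rightarrow> real \<Rightarrow> real) \<Rightarrow> real \<Rightarrow> real \<Rightarrow> (real \<Rightarrow> real) \<Rightarrow> (real \<Rightarrow> real) \<Rightarrow> real" where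
  "cost D v a b d u =
     integral {a..b} (\<lambda>t. v t (t - d t) +
       (pd1 D v t (t - d t) + pd2 D v t (t - d t) * (1 - u t)) / v t (t - d t))
     + ln (v a (a - d a))"

definition area :: "real \<Rightarrow> (real \<Rightarrow> real) \<Rightarrow> real \<Rightarrow> real" where
  "area a d t = integral {a..t} d"

definition optimal ::
    "(real \<times> real) set \<Rightarrow> (real \<Rightarrow> real \<Rightarrow> real) \<Rightarrow> real \<Rightarrow> real \<Rightarrow> real \<Rightarrow> (real \<Rightarrow> real) \<Rightarrow> (real \<Rightarrow> real) \<Rightarrow> bool"
where
  "optimal D v a d0 b d u \<longleftrightarrow> admissible D a d0 b d u \<and>
     (\<forall>b' d' u'. admissible D a d0 b' d' u' \<longrightarrow> cost D v a b d u \<le> cost D v a b' d' u')"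

definition area_optimal ::
    "(real \<times> real) set \<Rightarrow> (real \<Rightarrow> real \<Rightarrow> real) \<Rightarrow> real \<Rightarrow> real \<Rightarrow> real \<Rightarrow> real \<Rightarrow> (real \<Rightarrow> real) \<Rightarrow> (real \<Rightarrow> real) \<Rightarrow> bool"
where
  "area_optimal D v a d0 K b d u \<longleftrightarrow> admissible D a d0 b d u \<and> area a d b = K \<and>
     (\<forall>b' d' u'. admissible D a d0 b' d' u' \<and> area a d' b' = K \<longrightarrow>
        cost D v a b d u \<le> cost D v a b' d' u')"

text \<open>
  The Hamiltonian does not depend on the accumulated area \<open>e\<close>, which is why its costate \<open>r\<close> is constant.
\<close>

definition hamiltonian ::
    "(real \<times> real) set \<Rightarrow> (real \<Rightarrow> real \<Rightarrow> real) \<Rightarrow> real \<Rightarrow> real \<Rightarrow> real \<Rightarrow> real \<Rightarrow> real \<Rightarrow> real \<Rightarrow> real" where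
  "hamiltonian D v t d e u p r =
     running D v t (t - d) + (p - logd2 D v t (t - d)) * u + r * d"

definition min_hamiltonian ::
    "(real \<times> real) set \<Rightarrow> (real \<Rightarrow> real \<Rightarrow> real) \<Rightarrow> real \<Rightarrow> real \<Rightarrow> real \<Rightarrow> real \<Rightarrow> real \<Rightarrow> real" where
  "min_hamiltonian D v t d e p r = (INF w\<in>{0..1}. hamiltonian D v t d e w p r)"

definition minimum_principle ::
    "(real \<times> real) set \<Rightarrow> (real \<Rightarrow> real \<Rightarrow> real) \<Rightarrow> real \<Rightarrow> real \<Rightarrow> (real \<Rightarrow> real) \<Rightarrow> (real \<Rightarrow> real)
      \<Rightarrow> (real \<Rightarrow> real) \<Rightarrow> real \<Rightarrow> bool" where
  "minimum_principle D v a b d u p r \<longleftrightarrow>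
     (AE t in lebesgue_on {a..b}. \<forall>w\<in>{0..1}.
        hamiltonian D v t (d t) (area a d t) (u t) (p t) r
          \<le> hamiltonian D v t (d t) (area a d t) w (p t) r)"

text \<open>
  The costate equation, whose right-hand side is minus the derivative of the Hamiltonian with respect to
  \<open>d\<close>. As \<open>u\<close> is only measurable, it is written in integrated form.
\<close>

definition costate ::
    "(real \<times> real) set \<Rightarrow> (real \<Rightarrow> real \<Rightarrow> real) \<Rightarrow> real \<Rightarrow> real \<Rightarrow> (real \<Rightarrow> real) \<Rightarrow> (real \<Rightarrow> real)
      \<Rightarrow> (real \<Rightarrow> real) \<Rightarrow> real \<Rightarrow> bool" where
  "costate D v a b d u p r \<longleftrightarrow> (\<forall>t\<in>{a..b}.
     ((\<lambda>s. pd2 D (running D v) s (s - d s) - pd2 D (logd2 D v) s (s - d s) * u s - r)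
        has_integral (p t - p a)) {a..t})"

text \<open>
  The three behaviours, distinguished by the sign of the coefficient of \<open>u\<close> in the Hamiltonian.
\<close>

definition constant_arc ::
    "(real \<times> real) set \<Rightarrow> (real \<Rightarrow> real \<Rightarrow> real) \<Rightarrow> (real \<Rightarrow> real) \<Rightarrow> (real \<Rightarrow> real)
      \<Rightarrow> (real \<Rightarrow> real) \<Rightarrow> real \<Rightarrow> real \<Rightarrow> bool" where
  "constant_arc D v d u p \<alpha> \<beta> \<longleftrightarrow>
     (AE t in lebesgue_on {\<alpha><..<\<beta>}. u t = 0) \<and> (\<forall>t\<in>{\<alpha><..<\<beta>}. p t > logd2 D v t (t - d t))"

definition singular_arc ::
    "(real \<times> real) set \<Rightarrow> (real \<Rightarrow> real \<Rightarrow> real) \<Rightarrow> (real \<Rightarrow> real)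
      \<Rightarrow> (real \<Rightarrow> real) \<Rightarrow> real \<Rightarrow> real \<Rightarrow> bool" where
  "singular_arc D v d p \<alpha> \<beta> \<longleftrightarrow> (\<forall>t\<in>{\<alpha><..<\<beta>}. p t = logd2 D v t (t - d t))"

definition full_slope_arc ::
    "(real \<times> real) set \<Rightarrow> (real \<Rightarrow> real \<Rightarrow> real) \<Rightarrow> (real \<Rightarrow> real) \<Rightarrow> (real \<Rightarrow> real)
      \<Rightarrow> (real \<Rightarrow> real) \<Rightarrow> real \<Rightarrow> real \<Rightarrow> bool" where
  "full_slope_arc D v d u p \<alpha> \<beta> \<longleftrightarrow>
     (AE t in lebesgue_on {\<alpha><..<\<beta>}. u t = 1) \<and> (\<forall>t\<in>{\<alpha><..<\<beta>}. p t \<le> logd2 D v t (t - d t))"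

definition costate_constant ::
    "(real \<times> real) set \<Rightarrow> (real \<Rightarrow> real \<Rightarrow> real) \<Rightarrow> (real \<Rightarrow> real) \<Rightarrow> (real \<Rightarrow> real) \<Rightarrow> real \<Rightarrow> real
      \<Rightarrow> real \<Rightarrow> real" where
  "costate_constant D v d p r \<alpha> t =
     p \<alpha> + integral {\<alpha>..t} (\<lambda>s. pd2 D (running D v) s (s - d \<alpha>)) - r * (t - \<alpha>)"

definition costate_full_slope ::
    "(real \<times> real) set \<Rightarrow> (real \<Rightarrow> real \<Rightarrow> real) \<Rightarrow> (real \<Rightarrow> real) \<Rightarrow> (real \<Rightarrow> real) \<Rightarrow> real \<Rightarrow> real
      \<Rightarrow> real \<Rightarrow> real" where
  "costate_full_slope D v d p r \<alpha> t =
     p \<alpha> + integral {\<alpha>..t} (\<lambda>s. pd2 D v s (\<alpha> - d \<alpha>))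
       + logd2 D v t (\<alpha> - d \<alpha>) - logd2 D v \<alpha> (\<alpha> - d \<alpha>) - r * (t - \<alpha>)"

end

theory Submission
  imports Defs
begin

text \<open>
  Since \<open>d' = u\<close>, the cost equals \<open>\<integral> \<nu>\<^sub>q(t, t - d(t)) dt + log \<nu>\<^sub>q(b, b - d(b))\<close>, in which
  the control no longer occurs. For any competitor \<open>e\<close> with \<open>e(a) = d(a)\<close> the path
  \<open>d + \<theta> (e - d)\<close> is admissible for \<open>0 \<le> \<theta> \<le> 1\<close>, and moving the end point from \<open>b\<close> to
  \<open>b \<plusminus> s\<close> restores the prescribed area when \<open>\<theta>\<close> is chosen as a suitable function of \<open>s\<close>.
  Optimality of \<open>d\<close> gives a linear inequality in \<open>e - d\<close>, in which the multiplier \<open>r\<close> of the area is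
  fixed by the vanishing of the Hamiltonian at \<open>b\<close>. Integrated by parts it reads
  \<open>\<integral> S (e' - u) dt \<ge> 0\<close>, where \<open>S = p - \<partial>\<^sub>2\<nu>\<^sub>q / \<nu>\<^sub>q\<close> is the coefficient of \<open>u\<close> in the
  Hamiltonian and \<open>S' = \<partial>\<^sub>2\<nu>\<^sub>q - r\<close>. Taking \<open>e'\<close> extremal according to the sign of \<open>S\<close> yields the minimum
  principle, and \<open>S = 0\<close> on an interval yields the structure equation.
\<close>

section \<open>Partial derivatives on a half-plane\<close>

text \<open>No general form of Pontryagin's principle is invoked. Competitors keep the initial value
  \<open>d a\<close>, so that no boundary term at \<open>a\<close> survives integration by parts.
  Two obstacles shape the argument. The control is only measurable, so \<open>d\<close> need not be
  differentiable at the free end. When \<open>b\<close> moves forward the slope can be chosen; when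
  it moves backward the unknown slope still lies in \<open>[0, 1]\<close>; so both directions can be
  charged at the slope that minimizes the Hamiltonian. And under the area constraint, in general
  neither \<open>b\<close> nor the path can be varied alone. Shifting \<open>b\<close> by a small
  signed amount \<open>x\<close> changes the area by about \<open>x * d b\<close> and the cost, to
  first order, by at most \<open>x * h\<close>, where \<open>h\<close> is
  \<open>terminal_hamiltonian\<close>. Compensating through the path exchanges area for cost at the
  rate \<open>h / d b\<close>, whence \<open>r = - h / d b\<close>. As \<open>d\<close> is
  non-decreasing, \<open>K > 0\<close> forces \<open>d b > 0\<close>. The Hamiltonian at
  \<open>b\<close> is then \<open>h + r * d b = 0\<close>.\<close>

definition half_plane :: "(real \<times> real) set \<Rightarrow> bool" where
  "half_plane D \<longleftrightarrow> D = {(x, y). y \<le> x} \<or> D = {(x, y). y < x}"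

text \<open>The partial derivatives are explicit arguments because \<open>pd1\<close> and
  \<open>pd2\<close> are values of a choice operator: quotients and logarithms are differentiated by
  formula, and \<open>pd1\<close>, \<open>pd2\<close> are recovered by uniqueness. \<open>D\<close>
  need not be a half-plane; integration by parts uses a strip.\<close>

definition has_partials ::
    "(real \<times> real) set \<Rightarrow> (real \<Rightarrow> real \<Rightarrow> real) \<Rightarrow> (real \<Rightarrow> real \<Rightarrow> real) \<Rightarrow> (real \<Rightarrow> real \<Rightarrow> real) \<Rightarrow> bool"
where
  "has_partials D f f1 f2 \<longleftrightarrow>
     (\<forall>x y. (x, y) \<in> D \<longrightarrow>
        ((\<lambda>z. f (fst z) (snd z)) has_derivative (\<lambda>z. f1 x y * fst z + f2 x y * snd z)) (at (x, y) within D)) \<and>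
     continuous_on D (\<lambda>z. f1 (fst z) (snd z)) \<and> continuous_on D (\<lambda>z. f2 (fst z) (snd z))"

lemma has_partialsD:
  assumes "has_partials D f f1 f2"
  shows "(x, y) \<in> D \<Longrightarrow>
      ((\<lambda>z. f (fst z) (snd z)) has_derivative (\<lambda>z. f1 x y * fst z + f2 x y * snd z)) (at (x, y) within D)"
    and "continuous_on D (\<lambda>z. f1 (fst z) (snd z))"
    and "continuous_on D (\<lambda>z. f2 (fst z) (snd z))"
    and "continuous_on D (\<lambda>z. f (fst z) (snd z))"
proof -
  show "(x, y) \<in> D \<Longrightarrow>
      ((\<lambda>z. f (fst z) (snd z)) has_derivative (\<lambda>z. f1 x y * fst z + f2 x y * snd z)) (at (x, y) within D)"
    and "continuous_on D (\<lambda>z. f1 (fst z) (snd z))"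
    and "continuous_on D (\<lambda>z. f2 (fst z) (snd z))"
    using assms unfolding has_partials_def by blast+
  show "continuous_on D (\<lambda>z. f (fst z) (snd z))"
    by (rule has_derivative_continuous_on[where f' = "\<lambda>w z. f1 (fst w) (snd w) * fst z + f2 (fst w) (snd w) * snd z"])
      (use assms in \<open>auto simp: has_partials_def\<close>)
qed

text \<open>From every point of \<open>D\<close> a horizontal segment runs to the right and a
  vertical one downward inside \<open>D\<close>, even on the diagonal. This makes a derivative
  within a slice unique.\<close>

lemma half_plane_slices_nontrivial:
  assumes "half_plane D" "(x, y) \<in> D"
  shows "at x within {s. (s, y) \<in> D} \<noteq> bot" and "at y within {s. (x, s) \<in> D} \<noteq> bot"
proof -
  have "{x..x+1} \<subseteq> {s. (s, y) \<in> D}" "{y-1..y} \<subseteq> {s. (x, s) \<in> D}"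
    using assms by (auto simp: half_plane_def)
  moreover have "at x within {x..x+1} \<noteq> bot" "at y within {y-1..y} \<noteq> bot"
    by (auto simp: trivial_limit_within islimpt_Icc)
  ultimately show "at x within {s. (s, y) \<in> D} \<noteq> bot" "at y within {s. (x, s) \<in> D} \<noteq> bot"
    by (metis at_le bot.extremum_uniqueI)+
qed

lemma has_derivative_slices:
  assumes "((\<lambda>z. f (fst z) (snd z)) has_derivative (\<lambda>z. A * fst z + B * snd z)) (at (x, y) within D)"
  shows "((\<lambda>s. f s y) has_real_derivative A) (at x within {s. (s, y) \<in> D})"
    and "((\<lambda>s. f x s) has_real_derivative B) (at y within {s. (x, s) \<in> D})"
proof -
  have "((\<lambda>s. (s, y)) has_derivative (\<lambda>h. (h, 0))) (at x within {s. (s, y) \<in> D})"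
    by (auto intro!: derivative_eq_intros)
  moreover have "((\<lambda>z. f (fst z) (snd z)) has_derivative (\<lambda>z. A * fst z + B * snd z))
      (at (x, y) within (\<lambda>s. (s, y)) ` {s. (s, y) \<in> D})"
    by (rule has_derivative_subset[OF assms]) auto
  ultimately show "((\<lambda>s. f s y) has_real_derivative A) (at x within {s. (s, y) \<in> D})"
    using has_derivative_in_compose[of "\<lambda>s. (s, y)" "\<lambda>h. (h, 0)" x "{s. (s, y) \<in> D}"
        "\<lambda>z. f (fst z) (snd z)" "\<lambda>z. A * fst z + B * snd z"]
    by (simp add: has_field_derivative_def)
next
  have "((\<lambda>s. (x, s)) has_derivative (\<lambda>h. (0, h))) (at y within {s. (x, s) \<in> D})"
    by (auto intro!: derivative_eq_intros)
  moreover have "((\<lambda>z. f (fst z) (snd z)) has_derivative (\<lambda>z. A * fst z + B * snd z))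
      (at (x, y) within (\<lambda>s. (x, s)) ` {s. (x, s) \<in> D})"
    by (rule has_derivative_subset[OF assms]) auto
  ultimately show "((\<lambda>s. f x s) has_real_derivative B) (at y within {s. (x, s) \<in> D})"
    using has_derivative_in_compose[of "\<lambda>s. (x, s)" "\<lambda>h. (0, h)" y "{s. (x, s) \<in> D}"
        "\<lambda>z. f (fst z) (snd z)" "\<lambda>z. A * fst z + B * snd z"]
    by (simp add: has_field_derivative_def)
qed

lemma pd_eqI:
  assumes "half_plane D" "(x, y) \<in> D"
    and "((\<lambda>z. f (fst z) (snd z)) has_derivative (\<lambda>z. A * fst z + B * snd z)) (at (x, y) within D)"
  shows "pd1 D f x y = A" and "pd2 D f x y = B"
  unfolding pd1_def pd2_def
  using has_derivative_slices[OF assms(3)] half_plane_slices_nontrivial[OF assms(1,2)]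
  by (simp_all add: vector_derivative_within has_real_derivative_iff_has_vector_derivative)

lemma linear_real_pair:
  fixes f :: "real \<times> real \<Rightarrow> real"
  assumes "linear f"
  shows "f z = f (1, 0) * fst z + f (0, 1) * snd z"
proof -
  have "z = fst z *\<^sub>R (1, 0) + snd z *\<^sub>R (0, 1)"
    by (simp add: prod_eq_iff)
  then have "f z = f (fst z *\<^sub>R (1, 0)) + f (snd z *\<^sub>R (0, 1))"
    by (metis assms linear_add)
  then show ?thesis
    by (simp only: linear_scale[OF assms]) (simp add: mult.commute)
qed

text \<open>A linear map on the plane is given by two coefficients; uniqueness along the slices
  identifies them with \<open>pd1\<close> and \<open>pd2\<close>.\<close>

lemma Ck_on_Suc_has_derivative:
  assumes "half_plane D" "Ck_on (Suc k) D f" "(x, y) \<in> D"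
  shows "((\<lambda>z. f (fst z) (snd z)) has_derivative (\<lambda>z. pd1 D f x y * fst z + pd2 D f x y * snd z))
    (at (x, y) within D)"
proof -
  have "(\<lambda>(x, y). f x y) differentiable (at (x, y) within D)"
    using assms(2,3) by (auto simp: differentiable_on_def)
  then obtain A where A: "((\<lambda>z. f (fst z) (snd z)) has_derivative A) (at (x, y) within D)"
    unfolding differentiable_def case_prod_unfold by blast
  then have "A = (\<lambda>z. A (1, 0) * fst z + A (0, 1) * snd z)"
    using linear_real_pair has_derivative_linear by blast
  with A pd_eqI[OF assms(1,3), of f] show ?thesis by metis
qed

lemma Ck_on_1_has_partials:
  assumes "half_plane D" "Ck_on (Suc 0) D f"
  shows "has_partials D f (pd1 D f) (pd2 D f)"
  unfolding has_partials_def
  using Ck_on_Suc_has_derivative[OF assms] assms(2) by (auto simp: case_prod_unfold)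

lemma Ck_on_2_has_partials:
  assumes "half_plane D" "Ck_on 2 D f"
  shows "has_partials D f (pd1 D f) (pd2 D f)"
    and "has_partials D (pd1 D f) (pd1 D (pd1 D f)) (pd2 D (pd1 D f))"
    and "has_partials D (pd2 D f) (pd1 D (pd2 D f)) (pd2 D (pd2 D f))"
proof -
  have C: "Ck_on (Suc (Suc 0)) D f" using assms(2) by (simp only: numeral_2_eq_2)
  then have C1: "Ck_on (Suc 0) D (pd1 D f)" and C2: "Ck_on (Suc 0) D (pd2 D f)" by simp_all
  show h1: "has_partials D (pd1 D f) (pd1 D (pd1 D f)) (pd2 D (pd1 D f))"
    and h2: "has_partials D (pd2 D f) (pd1 D (pd2 D f)) (pd2 D (pd2 D f))"
    using Ck_on_1_has_partials[OF assms(1)] C1 C2 by blast+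
  show "has_partials D f (pd1 D f) (pd2 D f)"
    unfolding has_partials_def
    using Ck_on_Suc_has_derivative[OF assms(1) C] has_partialsD(4)[OF h1] has_partialsD(4)[OF h2] by blast
qed

text \<open>The mean value theorem, once in each variable. Apart from the order of its terms the
  second difference is symmetric in the two variables, so the lemma also applies with their roles
  exchanged.\<close>

lemma mixed_difference_mvt:
  fixes f f1 f12 :: "real \<Rightarrow> real \<Rightarrow> real"
  assumes "0 < h"
    and d1: "\<And>s t. s \<in> {x..x+h} \<Longrightarrow> t \<in> {y..y+h} \<Longrightarrow>
        ((\<lambda>s. f s t) has_real_derivative f1 s t) (at s within {x..x+h})"
    and d2: "\<And>s t. s \<in> {x..x+h} \<Longrightarrow> t \<in> {y..y+h} \<Longrightarrow>
        ((\<lambda>t. f1 s t) has_real_derivative f12 s t) (at t within {y..y+h})"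
  shows "\<exists>s t. s \<in> {x..x+h} \<and> t \<in> {y..y+h} \<and>
    (f (x+h) (y+h) - f (x+h) y) - (f x (y+h) - f x y) = h * h * f12 s t"
proof -
  have "\<exists>s\<in>{x<..<x+h}. (f (x+h) (y+h) - f (x+h) y) - (f x (y+h) - f x y)
      = (x + h - x) * (f1 s (y+h) - f1 s y)"
    by (rule mvt_simple[of x "x+h" "\<lambda>s. f s (y+h) - f s y" "\<lambda>s z. z * (f1 s (y+h) - f1 s y)",
          unfolded has_field_derivative_def[symmetric]])
      (use \<open>0 < h\<close> in \<open>auto intro!: derivative_eq_intros d1 simp: has_field_derivative_def[symmetric] mult_commute_abs\<close>)
  then obtain s where s: "s \<in> {x<..<x+h}" and e1: "(f (x+h) (y+h) - f (x+h) y) - (f x (y+h) - f x y)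
      = h * (f1 s (y+h) - f1 s y)" by auto
  have "\<exists>t\<in>{y<..<y+h}. f1 s (y+h) - f1 s y = ((y+h) - y) * f12 s t"
    by (rule mvt_simple[of y "y+h" "\<lambda>t. f1 s t" "\<lambda>t z. z * f12 s t"])
      (use \<open>0 < h\<close> s in \<open>auto intro!: d2 simp: has_field_derivative_def[symmetric] mult_commute_abs\<close>)
  then obtain t where t: "t \<in> {y<..<y+h}" "f1 s (y+h) - f1 s y = h * f12 s t" by auto
  show ?thesis
    by (rule exI[of _ s], rule exI[of _ t]) (use e1 s t in auto)
qed

text \<open>
  The squares \<open>[x, x + h] \<times> [y - h, y]\<close> stay in the half-plane even if \<open>(x, y)\<close> lies on the diagonal.
\<close>

lemma mixed_partials_eq:
  assumes hp: "half_plane D" and xy: "(x, y) \<in> D"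
    and f: "has_partials D f f1 f2" and f1: "has_partials D f1 f11 f12" and f2: "has_partials D f2 f21 f22"
  shows "f12 x y = f21 x y"
proof -
  define h where "h n = inverse (real (Suc n))" for n
  have h: "0 < h n" for n by (simp add: h_def)
  have sub: "(s, t) \<in> D" if "s \<in> {x..x + h n}" "t \<in> {y - h n..y - h n + h n}" for n s t
    using hp xy that by (auto simp: half_plane_def)
  have ex: "\<exists>s t s' t'. s \<in> {x..x + h n} \<and> t \<in> {y - h n..y} \<and> s' \<in> {x..x + h n} \<and> t' \<in> {y - h n..y} \<and>
      f12 s t = f21 s' t'" for n
  proof -
    have A: "\<exists>s t. s \<in> {x..x + h n} \<and> t \<in> {y - h n..y - h n + h n} \<and>
      (f (x + h n) (y - h n + h n) - f (x + h n) (y - h n)) - (f x (y - h n + h n) - f x (y - h n)) = h n * h n * f12 s t"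
    proof (rule mixed_difference_mvt[OF h])
      fix s t assume st: "s \<in> {x..x + h n}" "t \<in> {y - h n..y - h n + h n}"
      show "((\<lambda>s. f s t) has_real_derivative f1 s t) (at s within {x..x + h n})"
        by (rule DERIV_subset[OF has_derivative_slices(1)[OF has_partialsD(1)[OF f sub[OF st]]]])
          (use sub st in auto)
      show "((\<lambda>t. f1 s t) has_real_derivative f12 s t) (at t within {y - h n..y - h n + h n})"
        by (rule DERIV_subset[OF has_derivative_slices(2)[OF has_partialsD(1)[OF f1 sub[OF st]]]])
          (use sub st in auto)
    qed
    \<comment> \<open>The variables are exchanged, so that the same second difference is expressed
      through \<open>f21\<close>.\<close>
    have B: "\<exists>t s. t \<in> {y - h n..y - h n + h n} \<and> s \<in> {x..x + h n} \<and>
      (f (x + h n) (y - h n + h n) - f x (y - h n + h n)) - (f (x + h n) (y - h n) - f x (y - h n)) = h n * h n * f21 s t"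
    proof (rule mixed_difference_mvt[OF h, where f = "\<lambda>t s. f s t" and ?f1.0 = "\<lambda>t s. f2 s t" and ?f12.0 = "\<lambda>t s. f21 s t"])
      fix s t assume st: "t \<in> {y - h n..y - h n + h n}" "s \<in> {x..x + h n}"
      show "((\<lambda>t. f s t) has_real_derivative f2 s t) (at t within {y - h n..y - h n + h n})"
        by (rule DERIV_subset[OF has_derivative_slices(2)[OF has_partialsD(1)[OF f sub[OF st(2,1)]]]])
          (use sub st in auto)
      show "((\<lambda>s. f2 s t) has_real_derivative f21 s t) (at s within {x..x + h n})"
        by (rule DERIV_subset[OF has_derivative_slices(1)[OF has_partialsD(1)[OF f2 sub[OF st(2,1)]]]])
          (use sub st in auto)
    qed
    from A obtain s t where st: "s \<in> {x..x + h n}" "t \<in> {y - h n..y - h n + h n}"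
      and eA: "(f (x + h n) (y - h n + h n) - f (x + h n) (y - h n)) - (f x (y - h n + h n) - f x (y - h n)) = h n * h n * f12 s t"
      by blast
    from B obtain s' t' where st': "s' \<in> {x..x + h n}" "t' \<in> {y - h n..y - h n + h n}"
      and eB: "(f (x + h n) (y - h n + h n) - f x (y - h n + h n)) - (f (x + h n) (y - h n) - f x (y - h n)) = h n * h n * f21 s' t'"
      by blast
    from eA eB have "h n * h n * f12 s t = h n * h n * f21 s' t'" by linarith
    then have "f12 s t = f21 s' t'" using h[of n] by simp
    with st st' show ?thesis by auto
  qed
  then obtain s t s' t' where st: "\<And>n. s n \<in> {x..x + h n}" "\<And>n. t n \<in> {y - h n..y}"
      "\<And>n. s' n \<in> {x..x + h n}" "\<And>n. t' n \<in> {y - h n..y}" and eq: "\<And>n. f12 (s n) (t n) = f21 (s' n) (t' n)"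
    by metis
  have h0: "h \<longlonglongrightarrow> 0" unfolding h_def by (rule LIMSEQ_inverse_real_of_nat)
  have up: "(\<lambda>n. x + h n) \<longlonglongrightarrow> x" and lo: "(\<lambda>n. y - h n) \<longlonglongrightarrow> y"
    using tendsto_add[OF tendsto_const[of x] h0] tendsto_diff[OF tendsto_const[of y] h0] by simp_all
  have sx: "r \<longlonglongrightarrow> x" if "\<And>n. r n \<in> {x..x + h n}" for r
    by (rule tendsto_sandwich[OF _ _ tendsto_const[of x] up]) (use that in auto)
  have ty: "r \<longlonglongrightarrow> y" if "\<And>n. r n \<in> {y - h n..y}" for r
    by (rule tendsto_sandwich[OF _ _ lo tendsto_const[of y]]) (use that in auto)
  have lim: "(\<lambda>n. g (r n) (w n)) \<longlonglongrightarrow> g x y"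
    if g: "continuous_on D (\<lambda>z. g (fst z) (snd z))" and "\<And>n. r n \<in> {x..x + h n}" "\<And>n. w n \<in> {y - h n..y}"
    for g :: "real \<Rightarrow> real \<Rightarrow> real" and r w
  proof -
    have "(\<lambda>n. (r n, w n)) \<longlonglongrightarrow> (x, y)"
      by (rule tendsto_Pair[OF sx ty]) (use that in auto)
    then show ?thesis
      using continuous_on_tendsto_compose[OF g, of "\<lambda>n. (r n, w n)" "(x, y)" sequentially] xy
        sub[OF that(2)] that(3) by auto
  qed
  have "(\<lambda>n. f12 (s n) (t n)) \<longlonglongrightarrow> f12 x y"
    by (rule lim[OF has_partialsD(3)[OF f1] st(1,2)])
  moreover have "(\<lambda>n. f12 (s n) (t n)) \<longlonglongrightarrow> f21 x y"
    unfolding eq by (rule lim[OF has_partialsD(2)[OF f2] st(3,4)])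
  ultimately show ?thesis by (rule LIMSEQ_unique)
qed

section \<open>Quotients, logarithms and sums of continuously differentiable functions\<close>

lemma has_partials_divide:
  assumes f: "has_partials D f f1 f2" and g: "has_partials D g g1 g2" and pos: "\<forall>(x, y)\<in>D. g x y > 0"
  shows "has_partials D (\<lambda>x y. f x y / g x y)
    (\<lambda>x y. (f1 x y * g x y - f x y * g1 x y) / (g x y)\<^sup>2) (\<lambda>x y. (f2 x y * g x y - f x y * g2 x y) / (g x y)\<^sup>2)"
proof -
  have nz: "g (fst z) (snd z) \<noteq> 0" if "z \<in> D" for z using pos that by force
  have "((\<lambda>z. f (fst z) (snd z) / g (fst z) (snd z)) has_derivative
      (\<lambda>z. (f1 x y * g x y - f x y * g1 x y) / (g x y)\<^sup>2 * fst z + (f2 x y * g x y - f x y * g2 x y) / (g x y)\<^sup>2 * snd z))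
      (at (x, y) within D)" if xy: "(x, y) \<in> D" for x y
    by (rule has_derivative_eq_rhs, rule has_derivative_divide'[OF has_partialsD(1)[OF f xy] has_partialsD(1)[OF g xy]])
      (use nz[OF xy] in \<open>auto simp: fun_eq_iff power2_eq_square divide_simps algebra_simps\<close>)
  moreover have "continuous_on D (\<lambda>z. (f1 (fst z) (snd z) * g (fst z) (snd z) - f (fst z) (snd z) * g1 (fst z) (snd z)) / (g (fst z) (snd z))\<^sup>2)"
    by (intro continuous_on_divide continuous_on_diff continuous_on_mult continuous_on_power
        has_partialsD[OF f] has_partialsD[OF g]) (use nz in auto)
  moreover have "continuous_on D (\<lambda>z. (f2 (fst z) (snd z) * g (fst z) (snd z) - f (fst z) (snd z) * g2 (fst z) (snd z)) / (g (fst z) (snd z))\<^sup>2)"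
    by (intro continuous_on_divide continuous_on_diff continuous_on_mult continuous_on_power
        has_partialsD[OF f] has_partialsD[OF g]) (use nz in auto)
  ultimately show ?thesis unfolding has_partials_def by blast
qed

lemma has_partials_ln:
  assumes g: "has_partials D g g1 g2" and pos: "\<forall>(x, y)\<in>D. g x y > 0"
  shows "has_partials D (\<lambda>x y. ln (g x y)) (\<lambda>x y. g1 x y / g x y) (\<lambda>x y. g2 x y / g x y)"
proof -
  have p: "g (fst z) (snd z) > 0" if "z \<in> D" for z using pos that by force
  have "((\<lambda>z. ln (g (fst z) (snd z))) has_derivative
      (\<lambda>z. g1 x y / g x y * fst z + g2 x y / g x y * snd z)) (at (x, y) within D)" if xy: "(x, y) \<in> D" for x y
    by (rule has_derivative_eq_rhs, rule has_derivative_ln[OF _ has_partialsD(1)[OF g xy]])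
      (use p[OF xy] in \<open>auto simp: fun_eq_iff field_simps\<close>)
  moreover have "continuous_on D (\<lambda>z. g1 (fst z) (snd z) / g (fst z) (snd z))"
    "continuous_on D (\<lambda>z. g2 (fst z) (snd z) / g (fst z) (snd z))"
    by (intro continuous_on_divide has_partialsD[OF g]; use p in force)+
  ultimately show ?thesis unfolding has_partials_def by blast
qed

lemma has_partials_add:
  assumes f: "has_partials D f f1 f2" and g: "has_partials D g g1 g2"
  shows "has_partials D (\<lambda>x y. f x y + g x y) (\<lambda>x y. f1 x y + g1 x y) (\<lambda>x y. f2 x y + g2 x y)"
  unfolding has_partials_def
  by (intro conjI allI impI continuous_on_add has_partialsD[OF f] has_partialsD[OF g],
      rule has_derivative_eq_rhs, rule has_derivative_add[OF has_partialsD(1)[OF f] has_partialsD(1)[OF g]])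
    (auto simp: fun_eq_iff algebra_simps)

lemma has_partials_pd:
  assumes "half_plane D" "has_partials D f f1 f2" "(x, y) \<in> D"
  shows "pd1 D f x y = f1 x y" "pd2 D f x y = f2 x y"
  using pd_eqI[OF assms(1,3) has_partialsD(1)[OF assms(2,3)]] by auto

lemma has_partials_pd_self:
  assumes "half_plane D" "has_partials D f f1 f2"
  shows "has_partials D f (pd1 D f) (pd2 D f)"
proof -
  have eq: "f1 x y = pd1 D f x y" "f2 x y = pd2 D f x y" if "(x, y) \<in> D" for x y
    using has_partials_pd[OF assms that] by simp_all
  have "continuous_on D (\<lambda>z. pd1 D f (fst z) (snd z))" "continuous_on D (\<lambda>z. pd2 D f (fst z) (snd z))"
    using has_partialsD(2,3)[OF assms(2)] eq by (auto cong: continuous_on_cong)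
  then show ?thesis
    unfolding has_partials_def using has_partialsD(1)[OF assms(2)] eq by simp
qed

lemma has_partials_logd2:
  assumes hp: "half_plane D" and v: "Ck_on 2 D v" and pos: "\<forall>(x, y)\<in>D. v x y > 0"
  shows "has_partials D (logd2 D v) (pd1 D (logd2 D v)) (pd2 D (logd2 D v))"
  using has_partials_pd_self[OF hp has_partials_divide[OF Ck_on_2_has_partials(3,1)[OF hp v] pos]]
  by (simp add: logd2_def[abs_def])

text \<open>\<open>running\<close> is \<open>v\<close> plus the sum of both partial derivatives of
  \<open>ln v\<close>, and \<open>logd2\<close> is the second of them. Commuting the mixed partials
  of \<open>v\<close> moves the derivative onto \<open>logd2\<close>. The last two summands are what
  the chain rule along \<open>t - d t\<close> produces for \<open>u = 0\<close>, which is why the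
  coefficient of the control satisfies a simpler equation than the costate.\<close>

lemma pd2_running:
  assumes hp: "half_plane D" and v: "Ck_on 2 D v" and pos: "\<forall>(x, y)\<in>D. v x y > 0" and xy: "(x, y) \<in> D"
  shows "pd2 D (running D v) x y = pd2 D v x y + pd1 D (logd2 D v) x y + pd2 D (logd2 D v) x y"
proof -
  note P = Ck_on_2_has_partials[OF hp v]
  note L = has_partials_pd[OF hp has_partials_divide[OF P(3,1) pos] xy, folded logd2_def]
  have R: "pd2 D (running D v) x y = pd2 D v x y +
      ((pd2 D (pd1 D v) x y + pd2 D (pd2 D v) x y) * v x y - (pd1 D v x y + pd2 D v x y) * pd2 D v x y) / (v x y)\<^sup>2"
    using has_partials_pd(2)[OF hp has_partials_add[OF P(1) has_partials_divide[OF has_partials_add[OF P(2,3)] P(1) pos]] xy]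
    by (simp add: running_def[abs_def])
  have "pd2 D (pd1 D v) x y = pd1 D (pd2 D v) x y"
    by (rule mixed_partials_eq[OF hp xy P])
  then show ?thesis
    unfolding R L[folded logd2_def[abs_def]] by (simp add: add_divide_distrib[symmetric] algebra_simps)
qed

section \<open>Trajectories\<close>

text \<open>Admissibility freed from the bound on the initial value: competitors share that value
  with \<open>d\<close>, and \<open>D\<close> can be replaced by an auxiliary domain.\<close>

definition trajectory ::
    "(real \<times> real) set \<Rightarrow> real \<Rightarrow> real \<Rightarrow> (real \<Rightarrow> real) \<Rightarrow> (real \<Rightarrow> real) \<Rightarrow> bool" where
  "trajectory D a b d u \<longleftrightarrow>
     a \<le> b \<and> u \<in> borel_measurable (lebesgue_on {a..b}) \<and> (\<forall>t\<in>{a..b}. u t \<in> {0..1}) \<and>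
     (\<forall>t\<in>{a..b}. (u has_integral (d t - d a)) {a..t}) \<and> (\<forall>t\<in>{a..b}. (t, t - d t) \<in> D)"

lemma admissible_iff_trajectory:
  "admissible D a d0 b d u \<longleftrightarrow> d a \<in> {0..d0} \<and> trajectory D a b d u"
  unfolding admissible_def trajectory_def by blast

lemma trajectoryD:
  assumes "trajectory D a b d u"
  shows "a \<le> b" "u \<in> borel_measurable (lebesgue_on {a..b})" "t \<in> {a..b} \<Longrightarrow> u t \<in> {0..1}"
    "t \<in> {a..b} \<Longrightarrow> (u has_integral (d t - d a)) {a..t}" "t \<in> {a..b} \<Longrightarrow> (t, t - d t) \<in> D"
  using assms unfolding trajectory_def by blast+

lemma trajectory_integral:
  assumes d: "trajectory D a b d u" and st: "a \<le> s" "s \<le> t" "t \<le> b"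
  shows "(u has_integral (d t - d s)) {s..t}"
proof -
  have "u integrable_on {a..t}" using trajectoryD(4)[OF d, of t] st by auto
  then have "u integrable_on {s..t}" by (rule integrable_subinterval_real) (use st in auto)
  moreover have "integral {a..s} u + integral {s..t} u = integral {a..t} u"
    by (rule Henstock_Kurzweil_Integration.integral_combine) (use st \<open>u integrable_on {a..t}\<close> in auto)
  moreover have "integral {a..s} u = d s - d a" "integral {a..t} u = d t - d a"
    using trajectoryD(4)[OF d, of s] trajectoryD(4)[OF d, of t] st by (auto simp: integral_unique)
  ultimately show ?thesis by (metis add.commute add_diff_cancel_left' diff_add_cancel diff_diff_eq2 integrable_integral)
qed

lemma trajectory_increment:
  assumes d: "trajectory D a b d u" and st: "a \<le> s" "s \<le> t" "t \<le> b"
  shows "0 \<le> d t - d s" "d t - d s \<le> t - s"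
proof -
  note I = trajectory_integral[OF d st]
  have b: "u r \<in> {0..1}" if "r \<in> {s..t}" for r using trajectoryD(3)[OF d] that st by auto
  show "0 \<le> d t - d s" by (rule has_integral_nonneg[OF I]) (use b in auto)
  have "((\<lambda>_. 1) has_integral (t - s)) {s..t}" using has_integral_const_real[of "1::real" s t] st by simp
  from has_integral_le[OF I this] b show "d t - d s \<le> t - s" by auto
qed

lemma trajectory_lipschitz:
  assumes d: "trajectory D a b d u" and st: "s \<in> {a..b}" "t \<in> {a..b}"
  shows "\<bar>d t - d s\<bar> \<le> \<bar>t - s\<bar>" "\<bar>(t - d t) - (s - d s)\<bar> \<le> \<bar>t - s\<bar>"
  using trajectory_increment[OF d, of s t] trajectory_increment[OF d, of t s] st
  by (cases "s \<le> t"; force simp: abs_if)+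

lemma trajectory_continuous:
  assumes d: "trajectory D a b d u"
  shows "continuous_on {a..b} d"
proof -
  have "1-lipschitz_on {a..b} d"
    by (rule lipschitz_onI) (use trajectory_lipschitz(1)[OF d] in \<open>auto simp: dist_real_def abs_minus_commute\<close>)
  then show ?thesis by (rule lipschitz_on_continuous_on)
qed

lemma continuous_on_along_trajectory:
  assumes d: "trajectory D a b d u" and f: "continuous_on D (\<lambda>z. f (fst z) (snd z))"
  shows "continuous_on {a..b} (\<lambda>t. f t (t - d t))"
proof -
  have "continuous_on {a..b} ((\<lambda>z. f (fst z) (snd z)) \<circ> (\<lambda>t. (t, t - d t)))"
    by (intro continuous_on_compose continuous_intros trajectory_continuous[OF d])
      (rule continuous_on_subset[OF f], use trajectoryD(5)[OF d] in auto)
  then show ?thesis by (simp add: o_def)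
qed

lemma integrable_continuous_mult_bounded:
  fixes g u :: "real \<Rightarrow> real"
  assumes g: "continuous_on {a..b} g" and u: "u \<in> borel_measurable (lebesgue_on {a..b})"
    and bound: "\<And>t. t \<in> {a..b} \<Longrightarrow> \<bar>u t\<bar> \<le> 1"
  shows "(\<lambda>t. g t * u t) absolutely_integrable_on {a..b}"
proof (rule measurable_bounded_by_integrable_imp_absolutely_integrable)
  show "(\<lambda>t. g t * u t) \<in> borel_measurable (lebesgue_on {a..b})"
    by (intro borel_measurable_times u continuous_imp_measurable_on_sets_lebesgue[OF g]) auto
  show "(\<lambda>t. \<bar>g t\<bar>) integrable_on {a..b}"
    by (intro integrable_continuous_interval continuous_intros g)
  show "norm (g t * u t) \<le> \<bar>g t\<bar>" if "t \<in> {a..b}" for t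
    using bound[OF that] by (simp add: abs_mult mult_left_le)
qed auto

text \<open>
  As \<open>u\<close> is only measurable, neither \<open>f t (t - d t)\<close> nor the integral need be differentiable, but their
  difference is, with derivative 0: up to \<open>o(t - t0)\<close> both grow by
  \<open>f1 (t - t0) + f2 ((t - t0) - (d t - d t0))\<close>, the partial derivatives being taken at \<open>t0\<close>.
\<close>

lemma integral_along_trajectory:
  assumes d: "trajectory D a b d u" and f: "has_partials D f f1 f2" and t: "t \<in> {a..b}"
  shows "((\<lambda>s. f1 s (s - d s) + f2 s (s - d s) * (1 - u s)) has_integral
    (f t (t - d t) - f a (a - d a))) {a..t}"
proof -
  define G where "G s = f1 s (s - d s) + f2 s (s - d s) * (1 - u s)" for s
  have f1c: "continuous_on {a..b} (\<lambda>t. f1 t (t - d t))" and f2c: "continuous_on {a..b} (\<lambda>t. f2 t (t - d t))"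
    by (intro continuous_on_along_trajectory[OF d] has_partialsD[OF f])+
  have "(\<lambda>s. f2 s (s - d s) * u s) integrable_on {a..b}"
    by (intro set_lebesgue_integral_eq_integral(1) integrable_continuous_mult_bounded f2c trajectoryD(2)[OF d])
      (use trajectoryD(3)[OF d] in force)
  moreover have "(\<lambda>s. f1 s (s - d s) + f2 s (s - d s)) integrable_on {a..b}"
    by (intro integrable_continuous_interval continuous_on_add f1c f2c)
  ultimately have "(\<lambda>s. f1 s (s - d s) + f2 s (s - d s) - f2 s (s - d s) * u s) integrable_on {a..b}"
    by (intro integrable_diff)
  then have Gi: "G integrable_on {a..b}"
    by (rule integrable_eq) (simp add: G_def algebra_simps)
  have der0: "((\<lambda>t. f t (t - d t) - integral {a..t} G) has_field_derivative 0) (at t0 within {a..b})"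
    if t0: "t0 \<in> {a..b}" for t0
  proof -
    define A B where "A = f1 t0 (t0 - d t0)" and "B = f2 t0 (t0 - d t0)"
    have zD: "(t, t - d t) \<in> D" if "t \<in> {a..b}" for t using trajectoryD(5)[OF d] that by auto
    have fd: "((\<lambda>z. f (fst z) (snd z)) has_derivative (\<lambda>z. A * fst z + B * snd z)) (at (t0, t0 - d t0) within D)"
      using has_partialsD(1)[OF f zD[OF t0]] by (simp add: A_def B_def)
    have near: "norm ((t, t - d t) - (t0, t0 - d t0)) \<le> 2 * \<bar>t - t0\<bar>" if "t \<in> {a..b}" for t
      using norm_Pair_le[of "t - t0" "(t - d t) - (t0 - d t0)"] trajectory_lipschitz(2)[OF d t0 that] by simp
    have "((\<lambda>t. f t (t - d t) - A * t - B * (t - d t)) has_derivative (\<lambda>_. 0)) (at t0 within {a..b})"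
      unfolding has_derivative_within_alt
    proof (intro conjI allI impI)
      fix e :: real assume "e > 0"
      then obtain \<delta> where \<delta>: "\<delta> > 0" and le: "\<And>z. z \<in> D \<Longrightarrow> norm (z - (t0, t0 - d t0)) < \<delta> \<Longrightarrow>
          \<bar>f (fst z) (snd z) - f t0 (t0 - d t0) - (A * fst (z - (t0, t0 - d t0)) + B * snd (z - (t0, t0 - d t0)))\<bar>
            \<le> (e / 2) * norm (z - (t0, t0 - d t0))"
        using fd[unfolded has_derivative_within_alt, THEN conjunct2, rule_format, of "e / 2"] by auto
      have "\<bar>(f t (t - d t) - A * t - B * (t - d t)) - (f t0 (t0 - d t0) - A * t0 - B * (t0 - d t0))\<bar> \<le> e * \<bar>t - t0\<bar>"
        if "t \<in> {a..b}" "\<bar>t - t0\<bar> < \<delta> / 2" for t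
      proof -
        have "\<bar>f t (t - d t) - f t0 (t0 - d t0) - (A * (t - t0) + B * ((t - d t) - (t0 - d t0)))\<bar>
            \<le> (e / 2) * norm ((t, t - d t) - (t0, t0 - d t0))"
          using le[OF zD[OF that(1)]] near[OF that(1)] that(2) by auto
        also have "\<dots> \<le> (e / 2) * (2 * \<bar>t - t0\<bar>)"
          using \<open>e > 0\<close> by (intro mult_left_mono near[OF that(1)]) auto
        finally show ?thesis by (simp add: algebra_simps)
      qed
      then show "\<exists>\<delta>>0. \<forall>t\<in>{a..b}. norm (t - t0) < \<delta> \<longrightarrow>
          norm ((f t (t - d t) - A * t - B * (t - d t)) - (f t0 (t0 - d t0) - A * t0 - B * (t0 - d t0)) - 0)
            \<le> e * norm (t - t0)"
        using \<delta> by (intro exI[of _ "\<delta> / 2"]) auto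
    qed simp
    moreover have "((\<lambda>t. integral {a..t} (\<lambda>s. G s - (A + B * (1 - u s)))) has_derivative (\<lambda>_. 0)) (at t0 within {a..b})"
    proof -
      have i: "(\<lambda>s. G s - (A + B * (1 - u s))) integrable_on {a..b}"
        using trajectoryD(4)[OF d, of b] trajectoryD(1)[OF d]
        by (intro integrable_diff Gi integrable_add integrable_const_ivl integrable_on_mult_right) auto
      \<comment> \<open>\<open>u\<close> need have no limit at \<open>t0\<close>, but
        \<open>1 - u\<close> is bounded, so the distance of the continuous coefficients from their
        values at \<open>t0\<close> controls the integrand.\<close>
      have bnd: "\<bar>G s - (A + B * (1 - u s))\<bar> \<le> \<bar>f1 s (s - d s) - A\<bar> + \<bar>f2 s (s - d s) - B\<bar>" if "s \<in> {a..b}" for s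
      proof -
        have "G s - (A + B * (1 - u s)) = (f1 s (s - d s) - A) + (f2 s (s - d s) - B) * (1 - u s)"
          by (simp add: G_def algebra_simps)
        also have "\<bar>\<dots>\<bar> \<le> \<bar>f1 s (s - d s) - A\<bar> + \<bar>(f2 s (s - d s) - B) * (1 - u s)\<bar>" by (rule abs_triangle_ineq)
        also have "\<bar>(f2 s (s - d s) - B) * (1 - u s)\<bar> \<le> \<bar>f2 s (s - d s) - B\<bar>"
          using trajectoryD(3)[OF d that] by (simp add: abs_mult mult_left_le)
        finally show ?thesis by simp
      qed
      have lim: "((\<lambda>s. \<bar>f1 s (s - d s) - A\<bar> + \<bar>f2 s (s - d s) - B\<bar>) \<longlongrightarrow> \<bar>A - A\<bar> + \<bar>B - B\<bar>) (at t0 within {a..b})"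
        using f1c[unfolded continuous_on_def] f2c[unfolded continuous_on_def] t0
        by (intro tendsto_intros) (auto simp: A_def B_def)
      have "((\<lambda>s. G s - (A + B * (1 - u s))) \<longlongrightarrow> 0) (at t0 within {a..b})"
        by (rule Lim_null_comparison[OF _ lim[simplified]])
          (use bnd in \<open>auto simp: eventually_at_filter\<close>)
      moreover have G0: "G t0 - (A + B * (1 - u t0)) = 0" by (simp add: G_def A_def B_def)
      ultimately have c: "continuous (at t0 within {a..b} - {}) (\<lambda>s. G s - (A + B * (1 - u s)))"
        by (simp add: continuous_within)
      from integral_has_vector_derivative_continuous_at[OF i _ finite.emptyI c] t0 G0
      show ?thesis by (simp add: has_vector_derivative_def)
    qed
    ultimately have "((\<lambda>t. (f t (t - d t) - A * t - B * (t - d t)) - integral {a..t} (\<lambda>s. G s - (A + B * (1 - u s)))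
        + (A * a + B * (a - d a))) has_derivative (\<lambda>_. 0 - 0 + 0)) (at t0 within {a..b})"
      by (intro derivative_intros)
    then have "((\<lambda>t. f t (t - d t) - integral {a..t} G) has_derivative (\<lambda>_. 0)) (at t0 within {a..b})"
    proof (rule has_derivative_transform[rotated 2, THEN has_derivative_eq_rhs])
      fix t assume t: "t \<in> {a..b}"
      have "((\<lambda>s. A + B * (1 - u s)) has_integral (A * (t - a) + B * ((t - a) - (d t - d a)))) {a..t}"
        using has_integral_add[OF has_integral_const_real[of A a t]
            has_integral_mult_right[of _ _ _ B, OF has_integral_diff[OF has_integral_const_real[of 1 a t] trajectoryD(4)[OF d t]]]] t
        by (simp add: mult.commute)
      moreover have "(G has_integral integral {a..t} G) {a..t}"
        using integrable_subinterval_real[OF Gi, of a t] t by (auto simp: integrable_integral)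
      ultimately have "integral {a..t} (\<lambda>s. G s - (A + B * (1 - u s))) =
          integral {a..t} G - (A * (t - a) + B * ((t - a) - (d t - d a)))"
        by (intro integral_unique has_integral_diff)
      then show "f t (t - d t) - integral {a..t} G = (f t (t - d t) - A * t - B * (t - d t)) -
          integral {a..t} (\<lambda>s. G s - (A + B * (1 - u s))) + (A * a + B * (a - d a))"
        by (simp add: algebra_simps)
    qed (use t0 in auto)
    then show ?thesis
      unfolding has_field_derivative_def by (rule has_derivative_eq_rhs) (simp add: fun_eq_iff)
  qed
  obtain c where "\<And>t. t \<in> {a..b} \<Longrightarrow> f t (t - d t) - integral {a..t} G = c"
    using has_field_derivative_zero_constant[OF _ der0] by (auto simp: convex_real_interval)
  from this[OF t] this[of a] t have "integral {a..t} G = f t (t - d t) - f a (a - d a)" by auto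
  moreover have "G integrable_on {a..t}" using integrable_subinterval_real[OF Gi, of a t] t by auto
  ultimately show ?thesis using integrable_integral unfolding G_def[abs_def] by metis
qed

lemma trajectoryI:
  assumes "a \<le> b" and b: "\<And>t. t \<in> {a..b} \<Longrightarrow> u t \<in> {0..1}"
    and I: "\<And>t. t \<in> {a..b} \<Longrightarrow> (u has_integral (d t - d a)) {a..t}"
    and D: "\<And>t. t \<in> {a..b} \<Longrightarrow> (t, t - d t) \<in> D"
  shows "trajectory D a b d u"
proof -
  have "u integrable_on {a..b}" using I[of b] \<open>a \<le> b\<close> by auto
  then have "u \<in> borel_measurable (lebesgue_on {a..b})"
    by (simp add: integrable_imp_measurable)
  with assms show ?thesis unfolding trajectory_def by blast
qed

text \<open>The quotient in the integrand is the derivative of \<open>ln v\<close> along the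
  trajectory, so it integrates to a difference whose value at \<open>a\<close> cancels the last
  summand of \<open>cost\<close>.\<close>

lemma trajectory_cost:
  assumes d: "trajectory D a b d u" and v: "has_partials D v (pd1 D v) (pd2 D v)" and pos: "\<forall>(x, y)\<in>D. v x y > 0"
  shows "cost D v a b d u = integral {a..b} (\<lambda>t. v t (t - d t)) + ln (v b (b - d b))"
proof -
  have b: "b \<in> {a..b}" using trajectoryD(1)[OF d] by simp
  have "((\<lambda>t. v t (t - d t)) has_integral integral {a..b} (\<lambda>t. v t (t - d t))) {a..b}"
    by (intro integrable_integral integrable_continuous_interval continuous_on_along_trajectory[OF d] has_partialsD(4)[OF v])
  from has_integral_add[OF this integral_along_trajectory[OF d has_partials_ln[OF v pos] b]]
  have "((\<lambda>t. v t (t - d t) +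
       (pd1 D v t (t - d t) + pd2 D v t (t - d t) * (1 - u t)) / v t (t - d t)) has_integral
       (integral {a..b} (\<lambda>t. v t (t - d t)) + (ln (v b (b - d b)) - ln (v a (a - d a))))) {a..b}"
    by (simp add: add_divide_distrib)
  then show ?thesis unfolding cost_def by (simp add: integral_unique)
qed

section \<open>Integration by parts and the construction of competitors\<close>

lemma trajectory_mono_domain:
  assumes "trajectory D a b d u" "\<And>t. t \<in> {a..b} \<Longrightarrow> (t, t - d t) \<in> E"
  shows "trajectory E a b d u"
  using assms unfolding trajectory_def by blast

lemma trajectory_restrict:
  assumes d: "trajectory D a b d u" and c: "a \<le> c" "c \<le> b"
  shows "trajectory D a c d u"
  by (rule trajectoryI) (use trajectoryD[OF d] c in auto)

text \<open>\<open>d\<close> has no pointwise derivative in general, so the product rule is obtained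
  as an instance of \<open>integral_along_trajectory\<close>. Later \<open>P\<close> is the
  switching function.\<close>

lemma trajectory_integration_by_parts:
  assumes d: "trajectory D a b d u"
    and P: "\<And>t. t \<in> {a..b} \<Longrightarrow> (P has_real_derivative P' t) (at t within {a..b})"
    and P': "continuous_on {a..b} P'"
  shows "((\<lambda>t. P' t * d t + P t * u t) has_integral (P b * d b - P a * d a)) {a..b}"
proof -
  \<comment> \<open>the chain rule for \<open>P x * (x - y)\<close>, which is \<open>P t * d t\<close> at \<open>(t, t - d t)\<close>\<close>
  let ?E = "{a..b} \<times> (UNIV :: real set)"
  have Pc: "continuous_on {a..b} P" by (rule DERIV_continuous_on[OF P])
  have "((\<lambda>z. P (fst z) * (fst z - snd z)) has_derivative
      (\<lambda>z. (P' x * (x - y) + P x) * fst z + - P x * snd z)) (at (x, y) within ?E)" if "(x, y) \<in> ?E" for x y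
  proof -
    have "(fst has_derivative fst) (at (x, y) within ?E)" by (rule has_derivative_fst[OF has_derivative_ident])
    moreover have "(P has_derivative (*) (P' x)) (at (fst (x, y)) within fst ` ?E)"
      using P[of x] that by (auto simp: has_field_derivative_def)
    ultimately have "((\<lambda>z. P (fst z)) has_derivative (\<lambda>z. P' x * fst z)) (at (x, y) within ?E)"
      by (rule has_derivative_in_compose)
    from has_derivative_mult[OF this has_derivative_diff[OF has_derivative_fst[OF has_derivative_ident] has_derivative_snd[OF has_derivative_ident]]]
    show ?thesis by (rule has_derivative_eq_rhs) (auto simp: fun_eq_iff algebra_simps)
  qed
  moreover have "continuous_on ?E (\<lambda>z. P' (fst z) * (fst z - snd z) + P (fst z))" "continuous_on ?E (\<lambda>z. - P (fst z))"
    by (intro continuous_intros continuous_on_compose2[OF P'] continuous_on_compose2[OF Pc]; auto)+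
  ultimately have h: "has_partials ?E (\<lambda>x y. P x * (x - y)) (\<lambda>x y. P' x * (x - y) + P x) (\<lambda>x y. - P x)"
    unfolding has_partials_def by simp
  \<comment> \<open>Membership in the strip restricts only \<open>t\<close>, so the same trajectory
    lies in it.\<close>
  have "trajectory ?E a b d u" by (rule trajectory_mono_domain[OF d]) auto
  from integral_along_trajectory[OF this h, of b] trajectoryD(1)[OF d] show ?thesis
    by (simp add: algebra_simps)
qed

text \<open>Postponing the end point needs a path beyond \<open>b\<close>; the slope
  \<open>w\<close> is free there and will be the minimizer of the terminal Hamiltonian.\<close>

definition extend_path :: "real \<Rightarrow> real \<Rightarrow> (real \<Rightarrow> real) \<Rightarrow> real \<Rightarrow> real" where
  "extend_path b w d t = (if t \<le> b then d t else d b + w * (t - b))"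

lemma trajectory_extend:
  assumes hp: "half_plane D" and d: "trajectory D a b d u" and w: "w \<in> {0..1}" and c: "b \<le> c"
  shows "trajectory D a c (extend_path b w d) (\<lambda>t. if t \<le> b then u t else w)"
proof (rule trajectoryI)
  note ab = trajectoryD(1)[OF d]
  show "a \<le> c" using ab c by simp
  show "(if t \<le> b then u t else w) \<in> {0..1}" if "t \<in> {a..c}" for t
    using trajectoryD(3)[OF d, of t] that w by auto
  show "(t, t - extend_path b w d t) \<in> D" if t: "t \<in> {a..c}" for t
  proof (cases "t \<le> b")
    case True
    then show ?thesis using trajectoryD(5)[OF d, of t] t by (auto simp: extend_path_def)
  next
    case False
    \<comment> \<open>A larger \<open>d\<close> lowers the second coordinate, which keeps the point
      in either half-plane.\<close>
    then have "w * (t - b) \<ge> 0" using w by auto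
    then show ?thesis using False trajectoryD(5)[OF d, of b] ab hp by (auto simp: extend_path_def half_plane_def)
  qed
  show "((\<lambda>t. if t \<le> b then u t else w) has_integral (extend_path b w d t - extend_path b w d a)) {a..t}"
    if t: "t \<in> {a..c}" for t
  proof (cases "t \<le> b")
    case True
    then show ?thesis using trajectoryD(4)[OF d, of t] t ab
      by (auto simp: extend_path_def intro: has_integral_eq)
  next
    case False
    have "((\<lambda>t. if t \<le> b then u t else w) has_integral (d b - d a)) {a..b}"
      using trajectoryD(4)[OF d, of b] ab by (auto intro: has_integral_eq)
    moreover have "((\<lambda>_. w) has_integral (w * (t - b))) {b..t}"
      using has_integral_const_real[of w b t] False by (simp add: mult.commute)
    \<comment> \<open>On this interval the controls differ at most at \<open>b\<close>, where the
      extended one keeps the value of \<open>u\<close>.\<close>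
    then have "((\<lambda>t. if t \<le> b then u t else w) has_integral (w * (t - b))) {b..t}"
      by (rule has_integral_spike_finite[of "{b}", rotated 2]) auto
    ultimately have "((\<lambda>t. if t \<le> b then u t else w) has_integral (d b - d a + w * (t - b))) {a..t}"
      by (rule has_integral_combine[rotated 2]) (use False ab in auto)
    then show ?thesis using False ab by (simp add: extend_path_def algebra_simps)
  qed
qed

lemma trajectory_convex_combination:
  assumes hp: "half_plane D" and d: "trajectory D a b d u" and e: "trajectory D a b e w" and \<theta>: "\<theta> \<in> {0..1}"
  shows "trajectory D a b (\<lambda>t. d t + \<theta> * (e t - d t)) (\<lambda>t. u t + \<theta> * (w t - u t))"
proof (rule trajectoryI)
  show "a \<le> b" using trajectoryD(1)[OF d] .
  have conv: "x + \<theta> * (y - x) = (1 - \<theta>) * x + \<theta> * y" for x y by (simp add: algebra_simps)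
  show "u t + \<theta> * (w t - u t) \<in> {0..1}" if "t \<in> {a..b}" for t
    using convexD_alt[of "{0..1::real}" "u t" "w t" \<theta>] trajectoryD(3)[OF d that] trajectoryD(3)[OF e that] \<theta>
    unfolding conv by auto
  show "(t, t - (d t + \<theta> * (e t - d t))) \<in> D" if "t \<in> {a..b}" for t
  proof -
    \<comment> \<open>In terms of \<open>d\<close>, membership in \<open>D\<close> reads
      \<open>d t \<ge> 0\<close> or \<open>d t > 0\<close>, a convex condition in both
      cases.\<close>
    have "convex {0::real..}" "convex {0::real<..}" by simp_all
    then have "d t + \<theta> * (e t - d t) \<in> S" if "d t \<in> S" "e t \<in> S" "S = {0..} \<or> S = {0<..}" for S
      using convexD_alt[of S "d t" "e t" \<theta>] \<theta> that unfolding conv by auto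
    from this[of "{0..}"] this[of "{0<..}"] show ?thesis
      using trajectoryD(5)[OF d that] trajectoryD(5)[OF e that] hp by (auto simp: half_plane_def)
  qed
  show "((\<lambda>t. u t + \<theta> * (w t - u t)) has_integral
      (d t + \<theta> * (e t - d t) - (d a + \<theta> * (e a - d a)))) {a..t}" if "t \<in> {a..b}" for t
    using has_integral_add[OF trajectoryD(4)[OF d that] has_integral_mult_right[of _ _ _ \<theta>, OF has_integral_diff[OF
      trajectoryD(4)[OF e that] trajectoryD(4)[OF d that]]]]
    by (simp add: algebra_simps)
qed

text \<open>Supplies the bang-bang competitors. Integrating a nonnegative control can only increase
  \<open>d\<close>, so the point at \<open>a\<close> decides membership in \<open>D\<close>.\<close>

lemma trajectory_of_control:
  assumes hp: "half_plane D" and ab: "a \<le> b" and x: "(a, a - x) \<in> D"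
    and w: "w \<in> borel_measurable (lebesgue_on {a..b})" "\<And>t. t \<in> {a..b} \<Longrightarrow> w t \<in> {0..1}"
  shows "trajectory D a b (\<lambda>t. x + integral {a..t} w) w"
proof (rule trajectoryI[OF ab w(2)])
  have "(\<lambda>t. 1 * w t) absolutely_integrable_on {a..b}"
    by (rule integrable_continuous_mult_bounded) (use w in force)+
  then have "w integrable_on {a..b}" by (simp add: set_lebesgue_integral_eq_integral(1))
  then have i: "w integrable_on {a..t}" if "t \<in> {a..b}" for t
    using that by (auto intro: integrable_subinterval_real)
  show "(w has_integral (x + integral {a..t} w - (x + integral {a..a} w))) {a..t}" if "t \<in> {a..b}" for t
    using i[OF that] by (simp add: integrable_integral)
  show "(t, t - (x + integral {a..t} w)) \<in> D" if "t \<in> {a..b}" for t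
  proof -
    have "integral {a..t} w \<ge> 0"
      by (rule Henstock_Kurzweil_Integration.integral_nonneg[OF i[OF that]]) (use w(2) that in auto)
    then show ?thesis using x hp by (auto simp: half_plane_def)
  qed
qed

section \<open>The first variation of the cost\<close>

text \<open>The curve need not be differentiable at 0: distance at most \<open>C * s\<close> from
  \<open>p0\<close> turns the remainder \<open>o(norm (p s - p0))\<close> into \<open>o(s)\<close>.
  The linear part \<open>A (p s - p0)\<close> is kept as it stands, to be estimated
  separately.\<close>

lemma has_derivative_along_curve:
  fixes f :: "'a::real_normed_vector \<Rightarrow> real" and p :: "real \<Rightarrow> 'a"
  assumes f: "(f has_derivative A) (at p0 within D)"
    and pD: "\<forall>\<^sub>F s in at_right 0. p s \<in> D" and le: "\<forall>\<^sub>F s in at_right 0. norm (p s - p0) \<le> C * s"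
  shows "((\<lambda>s. (f (p s) - f p0 - A (p s - p0)) / s) \<longlongrightarrow> 0) (at_right 0)"
proof (rule tendstoI)
  fix e :: real assume e: "e > 0"
  define c where "c = \<bar>C\<bar> + 1"
  have c: "c > 0" "C \<le> c" by (auto simp: c_def)
  obtain \<delta> where \<delta>: "\<delta> > 0" and H: "\<And>y. y \<in> D \<Longrightarrow> norm (y - p0) < \<delta> \<Longrightarrow>
      norm (f y - f p0 - A (y - p0)) \<le> (e / (2 * c)) * norm (y - p0)"
    using f[unfolded has_derivative_within_alt, THEN conjunct2, rule_format, of "e / (2 * c)"] e c by auto
  have "\<forall>\<^sub>F s in at_right 0. s \<in> {0<..<\<delta> / c}"
    by (rule eventually_at_right_real) (use \<delta> c in auto)
  with pD le show "\<forall>\<^sub>F s in at_right 0. dist ((f (p s) - f p0 - A (p s - p0)) / s) 0 < e"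
  proof eventually_elim
    case (elim s)
    have s: "s > 0" "c * s < \<delta>" using elim(3) c by (auto simp: field_simps)
    have n: "norm (p s - p0) \<le> c * s" using elim(2) c s by (smt (verit) mult_right_mono)
    have "\<bar>f (p s) - f p0 - A (p s - p0)\<bar> \<le> (e / (2 * c)) * norm (p s - p0)"
      using H[OF elim(1)] n s by simp
    also have "\<dots> \<le> (e / (2 * c)) * (c * s)" using n e c by (intro mult_left_mono) auto
    also have "\<dots> < e * s" using c e s by simp
    finally show ?case using s by (simp add: dist_real_def field_simps)
  qed
qed

text \<open>A mean value over an interval of length \<open>s\<close> whose parameter moves along
  with it, which calls for joint continuity. The endpoints are general so that the interval may lie
  on either side of \<open>b\<close>.\<close>

lemma integral_over_shrinking_interval:
  fixes \<phi> :: "real \<Rightarrow> real \<Rightarrow> real"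
  assumes c: "continuous_on ({0..1} \<times> {a..T}) (\<lambda>z. \<phi> (fst z) (snd z))"
    and \<theta>: "\<forall>\<^sub>F s in at_right 0. \<theta> s \<in> {0..1}" "(\<theta> \<longlongrightarrow> 0) (at_right 0)"
    and lr: "\<forall>\<^sub>F s in at_right 0. a \<le> l s \<and> r s \<le> T \<and> r s - l s = s"
    and lim: "(l \<longlongrightarrow> b) (at_right 0)" "(r \<longlongrightarrow> b) (at_right 0)" and b: "b \<in> {a..T}"
  shows "((\<lambda>s. integral {l s..r s} (\<phi> (\<theta> s)) / s) \<longlongrightarrow> \<phi> 0 b) (at_right 0)"
proof (rule tendstoI)
  fix e :: real assume e: "e > 0"
  have "continuous (at (0, b) within ({0..1} \<times> {a..T})) (\<lambda>z. \<phi> (fst z) (snd z))"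
    using c b by (auto simp: continuous_on_eq_continuous_within)
  then obtain \<delta> where \<delta>: "\<delta> > 0" and H: "\<And>z. z \<in> {0..1} \<times> {a..T} \<Longrightarrow> dist z (0, b) < \<delta> \<Longrightarrow>
      dist (\<phi> (fst z) (snd z)) (\<phi> 0 b) < e / 2"
    unfolding continuous_within_eps_delta using e by (metis fst_conv half_gt_zero snd_conv)
  have "\<forall>\<^sub>F s in at_right 0. dist (\<theta> s) 0 < \<delta> / 2" "\<forall>\<^sub>F s in at_right 0. dist (l s) b < \<delta> / 2"
      "\<forall>\<^sub>F s in at_right 0. dist (r s) b < \<delta> / 2"
    using \<delta> by (intro tendstoD \<theta> lim; simp)+
  moreover have "\<forall>\<^sub>F s in at_right 0. (0::real) < s" by (simp add: eventually_at_right_less)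
  ultimately show "\<forall>\<^sub>F s in at_right 0. dist (integral {l s..r s} (\<phi> (\<theta> s)) / s) (\<phi> 0 b) < e"
    using \<theta>(1) lr
  proof eventually_elim
    case (elim s)
    have b1: "\<bar>\<phi> (\<theta> s) t - \<phi> 0 b\<bar> \<le> e / 2" if t: "t \<in> {l s..r s}" for t
    proof -
      have "dist (\<theta> s, t) (0, b) \<le> \<bar>\<theta> s\<bar> + \<bar>t - b\<bar>"
        using norm_Pair_le[of "\<theta> s" "t - b"] by (simp add: dist_norm)
      moreover have "\<bar>l s - b\<bar> < \<delta> / 2" "\<bar>r s - b\<bar> < \<delta> / 2" "\<bar>\<theta> s\<bar> < \<delta> / 2"
        using elim by (simp_all add: dist_real_def)
      then have "\<bar>\<theta> s\<bar> + \<bar>t - b\<bar> < \<delta>" using t unfolding atLeastAtMost_iff by linarith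
      ultimately show ?thesis using H[of "(\<theta> s, t)"] elim t by (auto simp: dist_real_def)
    qed
    have "continuous_on {l s..r s} (\<phi> (\<theta> s))"
      by (rule continuous_on_compose2[OF c, of _ "\<lambda>t. (\<theta> s, t)", simplified])
        (use elim in \<open>auto intro!: continuous_intros\<close>)
    then have "((\<lambda>t. \<phi> (\<theta> s) t - \<phi> 0 b) has_integral (integral {l s..r s} (\<phi> (\<theta> s)) - (r s - l s) * \<phi> 0 b)) {l s..r s}"
      using has_integral_const_real[of "\<phi> 0 b" "l s" "r s"] elim
      by (intro has_integral_diff integrable_integral integrable_continuous_interval) auto
    from has_integral_bound_real[OF _ finite.emptyI this, of "e / 2"] b1 e elim
    have "\<bar>integral {l s..r s} (\<phi> (\<theta> s)) - s * \<phi> 0 b\<bar> \<le> e / 2 * s" by auto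
    also have "\<dots> < e * s" using elim e by simp
    finally have "\<bar>integral {l s..r s} (\<phi> (\<theta> s)) - s * \<phi> 0 b\<bar> / s < e" using elim by (simp add: field_simps)
    moreover have "integral {l s..r s} (\<phi> (\<theta> s)) / s - \<phi> 0 b = (integral {l s..r s} (\<phi> (\<theta> s)) - s * \<phi> 0 b) / s"
      using elim by (simp add: field_simps)
    ultimately show ?case using elim by (simp add: dist_real_def)
  qed
qed

text \<open>The sign \<open>\<sigma>\<close> lets the end move right, stay or move left while
  \<open>s\<close> runs through positive values. Both integrals carry the parameter
  \<open>\<theta> s\<close>: its effect on the fixed interval is treated separately.\<close>

lemma integral_variable_end:
  fixes \<phi> :: "real \<Rightarrow> real \<Rightarrow> real"
  assumes c: "continuous_on ({0..1} \<times> {a..T}) (\<lambda>z. \<phi> (fst z) (snd z))"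
    and \<theta>: "\<forall>\<^sub>F s in at_right 0. \<theta> s \<in> {0..1}" "(\<theta> \<longlongrightarrow> 0) (at_right 0)"
    and \<sigma>: "\<sigma> \<in> {-1, 0, 1}" and end_in: "\<forall>\<^sub>F s in at_right 0. b + \<sigma> * s \<in> {a..T}" and b: "b \<in> {a..T}"
  shows "((\<lambda>s. (integral {a..b + \<sigma> * s} (\<phi> (\<theta> s)) - integral {a..b} (\<phi> (\<theta> s))) / s) \<longlongrightarrow> \<sigma> * \<phi> 0 b) (at_right 0)"
proof -
  have int: "\<phi> x integrable_on {a..T}" if "x \<in> {0..1}" for x
    by (rule integrable_continuous_interval, rule continuous_on_compose2[OF c, of _ "\<lambda>t. (x, t)", simplified])
      (use that in \<open>auto intro!: continuous_intros\<close>)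
  have comb: "integral {a..t} (\<phi> x) - integral {a..s} (\<phi> x) = integral {s..t} (\<phi> x)"
    if "x \<in> {0..1}" "a \<le> s" "s \<le> t" "t \<le> T" for x s t
  proof -
    have "\<phi> x integrable_on {a..t}" using integrable_subinterval_real[OF int[OF that(1)], of a t] that by auto
    from Henstock_Kurzweil_Integration.integral_combine[OF that(2,3) this] show ?thesis by simp
  qed
  have idl: "((\<lambda>s. b + \<sigma> * s) \<longlongrightarrow> b + \<sigma> * 0) (at_right 0)" by (intro tendsto_intros)
  have pos: "\<forall>\<^sub>F s in at_right 0. (0::real) < s" by (simp add: eventually_at_right_less)
  consider "\<sigma> = 0" | "\<sigma> = 1" | "\<sigma> = -1" using \<sigma> by auto
  then show ?thesis
  proof cases
    case 1 then show ?thesis by simp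
  next
    case 2
    have "((\<lambda>s. integral {b..b + s} (\<phi> (\<theta> s)) / s) \<longlongrightarrow> \<phi> 0 b) (at_right 0)"
      by (rule integral_over_shrinking_interval[OF c \<theta> _ _ _ b])
        (use b idl 2 end_in in \<open>auto elim!: eventually_mono\<close>)
    moreover have "\<forall>\<^sub>F s in at_right 0. integral {b..b + s} (\<phi> (\<theta> s)) / s =
        (integral {a..b + \<sigma> * s} (\<phi> (\<theta> s)) - integral {a..b} (\<phi> (\<theta> s))) / s"
      using \<theta>(1) end_in pos
    proof eventually_elim
      case (elim s)
      then show ?case using comb[of "\<theta> s" b "b + s"] b 2 by simp
    qed
    ultimately show ?thesis using 2 by (simp add: tendsto_cong)
  next
    case 3
    have "((\<lambda>s. integral {b - s..b} (\<phi> (\<theta> s)) / s) \<longlongrightarrow> \<phi> 0 b) (at_right 0)"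
      by (rule integral_over_shrinking_interval[OF c \<theta> _ _ _ b])
        (use b idl 3 end_in in \<open>auto elim!: eventually_mono\<close>)
    then have "((\<lambda>s. - (integral {b - s..b} (\<phi> (\<theta> s)) / s)) \<longlongrightarrow> - \<phi> 0 b) (at_right 0)"
      by (rule tendsto_minus)
    moreover have "\<forall>\<^sub>F s in at_right 0. - (integral {b - s..b} (\<phi> (\<theta> s)) / s) =
        (integral {a..b + \<sigma> * s} (\<phi> (\<theta> s)) - integral {a..b} (\<phi> (\<theta> s))) / s"
      using \<theta>(1) end_in pos
    proof eventually_elim
      case (elim s)
      then have "integral {a..b + \<sigma> * s} (\<phi> (\<theta> s)) - integral {a..b} (\<phi> (\<theta> s)) = - integral {b - s..b} (\<phi> (\<theta> s))"
        using comb[of "\<theta> s" "b - s" b] b 3 by simp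
      then show ?case by simp
    qed
    ultimately show ?thesis using 3 by (simp add: tendsto_cong)
  qed
qed

text \<open>
  The path need not be differentiable at the end point \<open>b\<close>. The hypothesis \<open>slope\<close> says that moving \<open>b\<close>
  costs at most what it would if \<open>d\<close> had there the slope in \<open>[0, 1]\<close> that minimizes the Hamiltonian.
\<close>

lemma first_variation:
  fixes \<sigma> \<kappa> :: real
  assumes hp: "half_plane D" and f: "has_partials D f f1 f2" and g: "has_partials D g g1 g2"
    and d: "trajectory D a T d u" and e: "trajectory D a T e w" and b: "b \<in> {a..T}"
    and \<theta>: "\<forall>\<^sub>F s in at_right 0. \<theta> s \<in> {0..1}" and \<kappa>: "((\<lambda>s. \<theta> s / s) \<longlongrightarrow> \<kappa>) (at_right 0)"
    and \<sigma>: "\<sigma> \<in> {-1, 0, 1}" and end_in: "\<forall>\<^sub>F s in at_right 0. b + \<sigma> * s \<in> {a..T}"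
    and slope: "\<forall>\<^sub>F s in at_right 0. - g2 b (b - d b) * (d (b + \<sigma> * s) - d b) \<le> - (\<sigma> * s) * max 0 (g2 b (b - d b))"
    and opt: "\<forall>\<^sub>F s in at_right 0. integral {a..b} (\<lambda>t. f t (t - d t)) + g b (b - d b)
      \<le> integral {a..b + \<sigma> * s} (\<lambda>t. f t (t - (d t + \<theta> s * (e t - d t)))) +
         g (b + \<sigma> * s) (b + \<sigma> * s - (d (b + \<sigma> * s) + \<theta> s * (e (b + \<sigma> * s) - d (b + \<sigma> * s))))"
  shows "0 \<le> \<sigma> * (f b (b - d b) + g1 b (b - d b) + g2 b (b - d b) - max 0 (g2 b (b - d b)))
    + \<kappa> * (- integral {a..b} (\<lambda>t. f2 t (t - d t) * (e t - d t)) - g2 b (b - d b) * (e b - d b))"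
proof -
  define \<phi> where "\<phi> x t = f t (t - (d t + x * (e t - d t)))" for x t
  define \<delta> where "\<delta> t = e t - d t" for t
  define A B where "A = g1 b (b - d b)" and "B = g2 b (b - d b)"
  have pos: "\<forall>\<^sub>F s in at_right 0. (0::real) < s" by (simp add: eventually_at_right_less)
  have zD: "(t, t - (d t + x * (e t - d t))) \<in> D" if "x \<in> {0..1}" "t \<in> {a..T}" for x t
    using trajectoryD(5)[OF trajectory_convex_combination[OF hp d e that(1)] that(2)] .
  have dc: "continuous_on ({0..1::real} \<times> {a..T}) (\<lambda>z. d (snd z))"
    and ec: "continuous_on ({0..1::real} \<times> {a..T}) (\<lambda>z. e (snd z))"
    by (intro continuous_on_compose2[OF trajectory_continuous[OF d]] continuous_on_compose2[OF trajectory_continuous[OF e]]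
        continuous_intros; force)+
  have along: "continuous_on ({0..1} \<times> {a..T}) (\<lambda>z. h (snd z) (snd z - (d (snd z) + fst z * (e (snd z) - d (snd z)))))"
    if "continuous_on D (\<lambda>z. h (fst z) (snd z))" for h :: "real \<Rightarrow> real \<Rightarrow> real"
    by (rule continuous_on_compose2[OF that, of _ "\<lambda>z. (snd z, snd z - (d (snd z) + fst z * (e (snd z) - d (snd z))))", simplified])
      (use zD in \<open>auto intro!: continuous_intros dc ec\<close>)
  have \<phi>c: "continuous_on ({0..1} \<times> {a..T}) (\<lambda>z. \<phi> (fst z) (snd z))"
    unfolding \<phi>_def by (rule along[OF has_partialsD(4)[OF f]])
  have \<theta>0: "(\<theta> \<longlongrightarrow> 0) (at_right 0)"
  proof -
    have "((\<lambda>s. \<theta> s / s * s) \<longlongrightarrow> \<kappa> * 0) (at_right 0)" by (intro tendsto_mult \<kappa> tendsto_ident_at)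
    moreover have "\<forall>\<^sub>F s in at_right 0. \<theta> s / s * s = \<theta> s" using pos by eventually_elim simp
    ultimately show ?thesis by (simp add: tendsto_cong)
  qed
  have \<theta>C: "\<forall>\<^sub>F s in at_right 0. \<bar>\<theta> s\<bar> \<le> (\<bar>\<kappa>\<bar> + 1) * s"
  proof -
    have "\<forall>\<^sub>F s in at_right 0. dist (\<theta> s / s) \<kappa> < 1" by (rule tendstoD[OF \<kappa>]) simp
    then show ?thesis using pos
    proof eventually_elim
      case (elim s)
      then have "\<bar>\<theta> s\<bar> / s \<le> \<bar>\<kappa>\<bar> + 1" by (simp add: dist_real_def)
      then show ?case using elim by (simp add: field_simps)
    qed
  qed

  define \<Psi> where "\<Psi> x = integral {a..b} (\<phi> x)" for x
  define S where "S = integral {a..b} (\<lambda>t. f2 t (t - d t) * \<delta> t)"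
  \<comment> \<open>Differentiation under the integral. Membership in \<open>D\<close> is known for
    convex combinations only, so the parameter is confined to \<open>[0, 1]\<close> and the
    derivative at 0 is one-sided.\<close>
  have "((\<lambda>x. integral (cbox a b) (\<phi> x)) has_field_derivative
      integral (cbox a b) (\<lambda>t. - f2 t (t - (d t + 0 * (e t - d t))) * \<delta> t)) (at 0 within {0..1})"
  proof (rule leibniz_rule_field_derivative[where fx = "\<lambda>x t. - f2 t (t - (d t + x * (e t - d t))) * \<delta> t"])
    fix x t :: real assume x: "x \<in> {0..1}" and "t \<in> cbox a b"
    then have t: "t \<in> {a..T}" using b by auto
    have "((\<lambda>x. (t, t - (d t + x * (e t - d t)))) has_derivative (\<lambda>h. (0, - h * \<delta> t))) (at x within {0..1})"
      by (auto intro!: derivative_eq_intros simp: \<delta>_def)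
    moreover have "((\<lambda>z. f (fst z) (snd z)) has_derivative
        (\<lambda>z. f1 t (t - (d t + x * (e t - d t))) * fst z + f2 t (t - (d t + x * (e t - d t))) * snd z))
        (at (t, t - (d t + x * (e t - d t))) within (\<lambda>x. (t, t - (d t + x * (e t - d t)))) ` {0..1})"
      by (rule has_derivative_subset[OF has_partialsD(1)[OF f zD[OF x t]]]) (use zD t in auto)
    ultimately have "((\<lambda>x. f (fst (t, t - (d t + x * (e t - d t)))) (snd (t, t - (d t + x * (e t - d t))))) has_derivative
        (\<lambda>h. f1 t (t - (d t + x * (e t - d t))) * fst (0, - h * \<delta> t) + f2 t (t - (d t + x * (e t - d t))) * snd (0::real, - h * \<delta> t)))
        (at x within {0..1})"
      by (rule has_derivative_in_compose)
    then show "((\<lambda>x. \<phi> x t) has_field_derivative - f2 t (t - (d t + x * (e t - d t))) * \<delta> t) (at x within {0..1})"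
      unfolding has_field_derivative_def \<phi>_def fst_conv snd_conv
      by (rule has_derivative_eq_rhs) (auto simp: fun_eq_iff)
  next
    fix x :: real assume "x \<in> {0..1}"
    then have "continuous_on {a..b} (\<phi> x)"
      by (intro continuous_on_compose2[OF \<phi>c, of _ "\<lambda>t. (x, t)", simplified])
        (use b in \<open>auto intro!: continuous_intros\<close>)
    then show "\<phi> x integrable_on cbox a b"
      by (simp add: integrable_continuous_interval)
  next
    have "continuous_on ({0..1} \<times> {a..T}) (\<lambda>z. - f2 (snd z) (snd z - (d (snd z) + fst z * (e (snd z) - d (snd z)))) * \<delta> (snd z))"
      unfolding \<delta>_def by (intro continuous_intros along[OF has_partialsD(3)[OF f]] dc ec)
    then show "continuous_on ({0..1} \<times> cbox a b) (\<lambda>(x, t). - f2 t (t - (d t + x * (e t - d t))) * \<delta> t)"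
      unfolding case_prod_unfold by (rule continuous_on_subset) (use b in auto)
  qed auto
  then have "(\<Psi> has_field_derivative - S) (at 0 within {0..1})"
    by (simp add: \<Psi>_def[abs_def] S_def)
  then have "(\<Psi> has_derivative (\<lambda>h. - S * h)) (at 0 within {0..1})"
    unfolding has_field_derivative_def .
  then have "((\<lambda>s. (\<Psi> (\<theta> s) - \<Psi> 0 - (- S * (\<theta> s - 0))) / s) \<longlongrightarrow> 0) (at_right 0)"
    by (rule has_derivative_along_curve[where C = "\<bar>\<kappa>\<bar> + 1"]) (use \<theta> \<theta>C in auto)
  then have L1: "((\<lambda>s. (\<Psi> (\<theta> s) - \<Psi> 0 - (- S * (\<theta> s - 0))) / s + - S * (\<theta> s / s)) \<longlongrightarrow> 0 + - S * \<kappa>) (at_right 0)"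
    by (intro tendsto_intros \<kappa>)

  have L2: "((\<lambda>s. (integral {a..b + \<sigma> * s} (\<phi> (\<theta> s)) - integral {a..b} (\<phi> (\<theta> s))) / s) \<longlongrightarrow> \<sigma> * \<phi> 0 b) (at_right 0)"
    by (rule integral_variable_end[OF \<phi>c \<theta> \<theta>0 \<sigma> end_in b])

  define p where "p s = (b + \<sigma> * s, b + \<sigma> * s - (d (b + \<sigma> * s) + \<theta> s * \<delta> (b + \<sigma> * s)))" for s
  have \<delta>L: "\<bar>\<delta> t - \<delta> b\<bar> \<le> 2 * \<bar>t - b\<bar>" if "t \<in> {a..T}" for t
    using trajectory_lipschitz(1)[OF d b that] trajectory_lipschitz(1)[OF e b that] unfolding \<delta>_def by (smt (verit))
  have gd: "((\<lambda>z. g (fst z) (snd z)) has_derivative (\<lambda>z. A * fst z + B * snd z)) (at (b, b - d b) within D)"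
    unfolding A_def B_def by (rule has_partialsD(1)[OF g trajectoryD(5)[OF d b]])
  have \<sigma>1: "\<bar>\<sigma>\<bar> \<le> 1" using \<sigma> by auto
  \<comment> \<open>The summand 2 comes from the two coordinates of \<open>(t, t - d t)\<close>,
    each moving by at most \<open>s\<close>. The factor \<open>\<bar>\<kappa>\<bar> + 1\<close>
    bounds \<open>\<theta> s / s\<close>, and \<open>\<bar>\<delta> b\<bar> + 2\<close> bounds
    \<open>\<delta>\<close> at the shifted end for \<open>s < 1\<close>.\<close>
  define C where "C = 2 + (\<bar>\<kappa>\<bar> + 1) * (\<bar>\<delta> b\<bar> + 2)"
  have "((\<lambda>s. (g (fst (p s)) (snd (p s)) - g (fst (b, b - d b)) (snd (b, b - d b)) -
      (A * fst (p s - (b, b - d b)) + B * snd (p s - (b, b - d b)))) / s) \<longlongrightarrow> 0) (at_right 0)"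
  proof (rule has_derivative_along_curve[OF gd, where C = C])
    show "\<forall>\<^sub>F s in at_right 0. p s \<in> D"
      using \<theta> end_in by eventually_elim (use zD in \<open>auto simp: p_def \<delta>_def\<close>)
    have "\<forall>\<^sub>F s in at_right 0. s \<in> {0<..<1::real}" by (rule eventually_at_right_real) simp
    with \<theta>C end_in show "\<forall>\<^sub>F s in at_right 0. norm (p s - (b, b - d b)) \<le> C * s"
    proof eventually_elim
      case (elim s)
      define t where "t = b + \<sigma> * s"
      have ts: "\<bar>t - b\<bar> \<le> s" using \<sigma>1 elim(3) by (simp add: t_def abs_mult mult_left_le_one_le)
      have "\<bar>\<delta> t\<bar> \<le> \<bar>\<delta> b\<bar> + 2" using \<delta>L[of t] elim ts by (auto simp: t_def)
      then have m: "\<bar>\<theta> s * \<delta> t\<bar> \<le> ((\<bar>\<kappa>\<bar> + 1) * s) * (\<bar>\<delta> b\<bar> + 2)"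
        unfolding abs_mult using elim by (intro mult_mono) auto
      have "p s - (b, b - d b) = (t - b, ((t - d t) - (b - d b)) - \<theta> s * \<delta> t)"
        by (simp add: p_def t_def)
      then have "norm (p s - (b, b - d b)) \<le> \<bar>t - b\<bar> + \<bar>((t - d t) - (b - d b)) - \<theta> s * \<delta> t\<bar>"
        using norm_Pair_le[of "t - b" "((t - d t) - (b - d b)) - \<theta> s * \<delta> t"] by simp
      also have "\<dots> \<le> s + (s + ((\<bar>\<kappa>\<bar> + 1) * s) * (\<bar>\<delta> b\<bar> + 2))"
        using trajectory_lipschitz(2)[OF d b, of t] elim(2) ts m unfolding t_def[symmetric] by linarith
      also have "\<dots> = C * s" by (simp add: C_def algebra_simps)
      finally show ?case .
    qed
  qed
  then have L3: "((\<lambda>s. (g (fst (p s)) (snd (p s)) - g b (b - d b) -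
      (A * fst (p s - (b, b - d b)) + B * snd (p s - (b, b - d b)))) / s) \<longlongrightarrow> 0) (at_right 0)" by simp

  have L4: "((\<lambda>s. \<delta> (b + \<sigma> * s)) \<longlongrightarrow> \<delta> b) (at_right 0)"
  proof -
    have "((\<lambda>s. b + \<sigma> * s) \<longlongrightarrow> b + \<sigma> * 0) (at_right 0)" by (intro tendsto_intros)
    moreover have "continuous_on {a..T} \<delta>"
      unfolding \<delta>_def by (intro continuous_intros trajectory_continuous[OF d] trajectory_continuous[OF e])
    ultimately show ?thesis
      using continuous_on_tendsto_compose[of "{a..T}" \<delta> "\<lambda>s. b + \<sigma> * s" b] b end_in by simp
  qed

  \<comment> \<open>\<open>(d (b + \<sigma> * s) - d b) / s\<close> may have no limit. In the last
    summand its contribution is replaced by the bound from \<open>slope\<close>, which can only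
    increase the expression. What remains converges, and its nonnegativity passes to the
    limit.\<close>
  let ?U = "\<lambda>s. ((\<Psi> (\<theta> s) - \<Psi> 0 - (- S * (\<theta> s - 0))) / s + - S * (\<theta> s / s)) +
      (integral {a..b + \<sigma> * s} (\<phi> (\<theta> s)) - integral {a..b} (\<phi> (\<theta> s))) / s +
      (g (fst (p s)) (snd (p s)) - g b (b - d b) -
        (A * fst (p s - (b, b - d b)) + B * snd (p s - (b, b - d b)))) / s +
      (\<sigma> * (A + B - max 0 B) - B * (\<theta> s / s) * \<delta> (b + \<sigma> * s))"
  have "(?U \<longlongrightarrow> (0 + - S * \<kappa>) + \<sigma> * \<phi> 0 b + 0 + (\<sigma> * (A + B - max 0 B) - B * \<kappa> * \<delta> b)) (at_right 0)"
    by (intro tendsto_add[OF tendsto_add[OF tendsto_add[OF L1 L2] L3]] tendsto_intros \<kappa> L4)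
  moreover have "\<forall>\<^sub>F s in at_right 0. 0 \<le> ?U s"
    using opt slope pos
  proof eventually_elim
    case (elim s)
    define t where "t = b + \<sigma> * s"
    have "0 \<le> integral {a..t} (\<phi> (\<theta> s)) + g (fst (p s)) (snd (p s)) - (\<Psi> 0 + g b (b - d b))"
      using elim(1) by (simp add: \<phi>_def[abs_def] \<Psi>_def p_def \<delta>_def t_def)
    also have "\<dots> = (\<Psi> (\<theta> s) - \<Psi> 0) + (integral {a..t} (\<phi> (\<theta> s)) - integral {a..b} (\<phi> (\<theta> s))) + (g (fst (p s)) (snd (p s)) - g b (b - d b))"
      by (simp add: \<Psi>_def)
    also have "\<dots> \<le> s * ?U s"
    proof -
      have "s * ?U s = (\<Psi> (\<theta> s) - \<Psi> 0) + (integral {a..t} (\<phi> (\<theta> s)) - integral {a..b} (\<phi> (\<theta> s))) +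
          (g (fst (p s)) (snd (p s)) - g b (b - d b)) +
          (s * \<sigma> * (A + B - max 0 B) - B * \<theta> s * \<delta> t - (A * fst (p s - (b, b - d b)) + B * snd (p s - (b, b - d b))))"
        using elim(3) by (simp add: t_def field_simps)
      moreover have "A * fst (p s - (b, b - d b)) + B * snd (p s - (b, b - d b)) =
          A * (\<sigma> * s) + B * (\<sigma> * s) + - B * (d t - d b) - B * \<theta> s * \<delta> t"
        by (simp add: p_def t_def algebra_simps)
      moreover have "- B * (d t - d b) \<le> - (\<sigma> * s) * max 0 B" using elim(2) by (simp add: B_def t_def)
      ultimately show ?thesis by (simp add: algebra_simps)
    qed
    finally show ?case using elim(3) by (simp add: zero_le_mult_iff)
  qed
  ultimately have "0 \<le> (0 + - S * \<kappa>) + \<sigma> * \<phi> 0 b + 0 + (\<sigma> * (A + B - max 0 B) - B * \<kappa> * \<delta> b)"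
    by (intro tendsto_lowerbound) auto
  then show ?thesis by (simp add: \<phi>_def S_def A_def B_def \<delta>_def algebra_simps)
qed

text \<open>
  The minimum over \<open>u\<close> of the Hamiltonian at \<open>b\<close> for \<open>p(b) = 0\<close> and \<open>r = 0\<close>; to first order, it is the
  cost of increasing \<open>b\<close>. Next, the derivative of the cost in the direction \<open>\<delta>\<close> with \<open>b\<close> fixed.
\<close>

definition terminal_hamiltonian :: "(real \<times> real) set \<Rightarrow> (real \<Rightarrow> real \<Rightarrow> real) \<Rightarrow> real \<Rightarrow> (real \<Rightarrow> real) \<Rightarrow> real" where
  "terminal_hamiltonian D v b d = running D v b (b - d b) - max 0 (logd2 D v b (b - d b))"

definition path_derivative ::
    "(real \<times> real) set \<Rightarrow> (real \<Rightarrow> real \<Rightarrow> real) \<Rightarrow> real \<Rightarrow> real \<Rightarrow> (real \<Rightarrow> real) \<Rightarrow> (real \<Rightarrow> real) \<Rightarrow> real" where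
  "path_derivative D v a b d \<delta> =
     - integral {a..b} (\<lambda>t. pd2 D v t (t - d t) * \<delta> t) - logd2 D v b (b - d b) * \<delta> b"

section \<open>Variational inequalities at an optimum\<close>

lemma eventually_at_right_0_less: "c > 0 \<Longrightarrow> \<forall>\<^sub>F s in at_right 0. 0 < s \<and> s < (c::real)"
  using eventually_at_right_real[of 0 c] by (auto elim: eventually_mono)

lemma eventually_end_in:
  fixes a b \<sigma> :: real
  assumes "a \<le> b" "\<sigma> \<in> {-1, 0, 1}" "\<sigma> = -1 \<Longrightarrow> a < b"
  shows "\<forall>\<^sub>F s in at_right 0. b + \<sigma> * s \<in> {a..b + 1}"
proof -
  have "\<forall>\<^sub>F s in at_right 0. 0 < s \<and> s < (if \<sigma> = -1 then min 1 (b - a) else 1)"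
    by (rule eventually_at_right_0_less) (use assms in auto)
  then show ?thesis by eventually_elim (use assms in \<open>auto split: if_splits\<close>)
qed

text \<open>Going forward, the extension has the slope that attains \<open>max 0 B\<close>, so
  equality holds. Going backward, the increment of \<open>d\<close> lies between 0 and
  \<open>s\<close>, and \<open>max 0 B * s\<close> is the worst case. Both directions are thus
  charged with the same Hamiltonian, up to sign.\<close>

lemma extend_path_slope:
  assumes d: "trajectory D a b d u" and \<sigma>: "\<sigma> \<in> {-1, 0, 1}" "\<sigma> = -1 \<Longrightarrow> a < b"
    and w: "w = (if B \<ge> 0 then 1 else 0)"
  shows "\<forall>\<^sub>F s in at_right 0. - B * (extend_path b w d (b + \<sigma> * s) - extend_path b w d b) \<le> - (\<sigma> * s) * max 0 B"
proof -
  note ab = trajectoryD(1)[OF d]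
  have pos: "\<forall>\<^sub>F s in at_right 0. (0::real) < s" by (simp add: eventually_at_right_less)
  have "\<forall>\<^sub>F s in at_right 0. b + \<sigma> * s \<in> {a..b + 1}"
    by (rule eventually_end_in[OF ab \<sigma>])
  with pos show ?thesis
  proof eventually_elim
    case (elim s)
    consider "\<sigma> = 0" | "\<sigma> = 1" | "\<sigma> = -1" using \<sigma>(1) by auto
    then show ?case
    proof cases
      case 3
      have i: "0 \<le> d b - d (b - s)" "d b - d (b - s) \<le> s"
        using trajectory_increment[OF d, of "b - s" b] 3 elim by auto
      have "B * (d b - d (b - s)) \<le> max 0 B * (d b - d (b - s))"
        using i by (intro mult_right_mono) auto
      also have "\<dots> \<le> max 0 B * s" using i by (intro mult_left_mono) auto
      finally show ?thesis using 3 elim by (simp add: extend_path_def algebra_simps)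
    qed (use elim w in \<open>auto simp: extend_path_def\<close>)
  qed
qed

text \<open>An application of \<open>first_variation\<close> with running cost \<open>v\<close> and
  terminal cost \<open>ln v\<close>, on an interval enlarged to \<open>b + 1\<close> for room on the
  right. \<open>Q\<close> is the constraint on competitors: trivial in one problem, the prescribed
  area in the other.\<close>

lemma variation_inequality:
  assumes hp: "half_plane D" and v: "Ck_on 2 D v" and pos: "\<forall>(x, y)\<in>D. v x y > 0"
    and d: "trajectory D a b d u" and e: "trajectory D a b e w" and ea: "e a = d a"
    and \<theta>: "\<forall>\<^sub>F s in at_right 0. \<theta> s \<in> {0..1}" and \<kappa>: "((\<lambda>s. \<theta> s / s) \<longlongrightarrow> \<kappa>) (at_right 0)"
    and \<sigma>: "\<sigma> \<in> {-1, 0, 1}" "\<sigma> = -1 \<Longrightarrow> a < b"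
    and min: "\<And>b' d' u'. trajectory D a b' d' u' \<Longrightarrow> d' a = d a \<Longrightarrow> Q b' d' \<Longrightarrow> cost D v a b d u \<le> cost D v a b' d' u'"
    and w0: "w0 = (if logd2 D v b (b - d b) \<ge> 0 then 1 else 0)"
    and Q: "\<forall>\<^sub>F s in at_right 0. Q (b + \<sigma> * s)
      (\<lambda>t. extend_path b w0 d t + \<theta> s * (extend_path b w0 e t - extend_path b w0 d t))"
  shows "0 \<le> \<sigma> * terminal_hamiltonian D v b d + \<kappa> * path_derivative D v a b d (\<lambda>t. e t - d t)"
proof -
  let ?d = "extend_path b w0 d" and ?e = "extend_path b w0 e"
  note ab = trajectoryD(1)[OF d]
  note vp = Ck_on_2_has_partials(1)[OF hp v]
  have w01: "w0 \<in> {0..1}" using w0 by simp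
  note dx = trajectory_extend[OF hp d w01, of "b + 1", simplified]
  note ex = trajectory_extend[OF hp e w01, of "b + 1", simplified]
  have b1: "b \<in> {a..b + 1}" using ab by simp
  have eq: "?d t = d t" "?e t = e t" if "t \<in> {a..b}" for t using that by (auto simp: extend_path_def)
  have eqb: "?d b = d b" "?e b = e b" by (auto simp: extend_path_def)
  have eqa: "?d a = d a" "?e a = e a" using ab by (auto simp: extend_path_def)
  have end_in: "\<forall>\<^sub>F s in at_right 0. b + \<sigma> * s \<in> {a..b + 1}"
    by (rule eventually_end_in[OF ab \<sigma>])
  have slope: "\<forall>\<^sub>F s in at_right 0. - logd2 D v b (b - d b) * (?d (b + \<sigma> * s) - ?d b) \<le> - (\<sigma> * s) * max 0 (logd2 D v b (b - d b))"
    by (rule extend_path_slope[OF d \<sigma> w0])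
  have "0 \<le> \<sigma> * (v b (b - ?d b) + pd1 D v b (b - ?d b) / v b (b - ?d b) + pd2 D v b (b - ?d b) / v b (b - ?d b)
        - max 0 (pd2 D v b (b - ?d b) / v b (b - ?d b)))
    + \<kappa> * (- integral {a..b} (\<lambda>t. pd2 D v t (t - ?d t) * (?e t - ?d t)) - pd2 D v b (b - ?d b) / v b (b - ?d b) * (?e b - ?d b))"
  proof (rule first_variation[OF hp vp has_partials_ln[OF vp pos] dx ex b1 \<theta> \<kappa> \<sigma>(1) end_in])
    show "\<forall>\<^sub>F s in at_right 0. - (pd2 D v b (b - ?d b) / v b (b - ?d b)) * (?d (b + \<sigma> * s) - ?d b)
        \<le> - (\<sigma> * s) * max 0 (pd2 D v b (b - ?d b) / v b (b - ?d b))"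
      using slope unfolding eqb logd2_def .
    have "integral {a..b} (\<lambda>t. v t (t - d t)) = integral {a..b} (\<lambda>t. v t (t - ?d t))"
      by (rule integral_cong) (simp add: eq)
    then have J: "cost D v a b d u = integral {a..b} (\<lambda>t. v t (t - ?d t)) + ln (v b (b - ?d b))"
      by (simp add: trajectory_cost[OF d vp pos] eqb)
    show "\<forall>\<^sub>F s in at_right 0. integral {a..b} (\<lambda>t. v t (t - ?d t)) + ln (v b (b - ?d b))
      \<le> integral {a..b + \<sigma> * s} (\<lambda>t. v t (t - (?d t + \<theta> s * (?e t - ?d t)))) +
         ln (v (b + \<sigma> * s) (b + \<sigma> * s - (?d (b + \<sigma> * s) + \<theta> s * (?e (b + \<sigma> * s) - ?d (b + \<sigma> * s)))))"
      using \<theta> end_in Q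
    proof eventually_elim
      case (elim s)
      have tr: "trajectory D a (b + \<sigma> * s) (\<lambda>t. ?d t + \<theta> s * (?e t - ?d t))
         (\<lambda>t. (if t \<le> b then u t else w0) + \<theta> s * ((if t \<le> b then w t else w0) - (if t \<le> b then u t else w0)))"
        by (rule trajectory_restrict[OF trajectory_convex_combination[OF hp dx ex elim(1)]]) (use elim(2) in auto)
      have "?d a + \<theta> s * (?e a - ?d a) = d a" by (simp add: eqa ea)
      from min[OF tr this elim(3)] show ?case unfolding J[symmetric] trajectory_cost[OF tr vp pos] .
    qed
  qed
  moreover have "integral {a..b} (\<lambda>t. pd2 D v t (t - ?d t) * (?e t - ?d t)) = integral {a..b} (\<lambda>t. pd2 D v t (t - d t) * (e t - d t))"
    by (rule integral_cong) (simp add: eq)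
  ultimately show ?thesis
    by (simp add: eqb terminal_hamiltonian_def path_derivative_def running_def logd2_def add_divide_distrib add.assoc)
qed

lemma tendsto_self_divide_at_right_0: "((\<lambda>s. s / s) \<longlongrightarrow> 1) (at_right (0::real))"
  by (rule tendsto_eventually) (use eventually_at_right_less[of "0::real"] in \<open>auto elim: eventually_mono\<close>)

text \<open>Without a constraint the two variations decouple: the end moves in both directions along
  the extended path, and the path moves with the end fixed. The backward move needs
  \<open>a < b\<close>.\<close>

lemma optimal_inequality:
  assumes hp: "half_plane D" and v: "Ck_on 2 D v" and pos: "\<forall>(x, y)\<in>D. v x y > 0"
    and opt: "optimal D v a d0 b d u"
  shows "a < b \<Longrightarrow> terminal_hamiltonian D v b d = 0"
    and "trajectory D a b e w \<Longrightarrow> e a = d a \<Longrightarrow> 0 \<le> path_derivative D v a b d (\<lambda>t. e t - d t)"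
proof -
  have d: "trajectory D a b d u" and da: "d a \<in> {0..d0}"
    using opt unfolding optimal_def admissible_iff_trajectory by auto
  have min: "cost D v a b d u \<le> cost D v a b' d' u'" if "trajectory D a b' d' u'" "d' a = d a" "(\<lambda>_ _. True) b' d'" for b' d' u'
    using opt that da unfolding optimal_def admissible_iff_trajectory by auto
  note V = variation_inequality[OF hp v pos d _ _ _ _ _ _ _ refl, where Q = "\<lambda>_ _. True", OF _ _ _ _ _ _ min]
  { assume "a < b"
    have "0 \<le> \<sigma> * terminal_hamiltonian D v b d" if "\<sigma> \<in> {-1, 1}" for \<sigma>
      using V[OF d refl, of "\<lambda>_. 0" 0 \<sigma>] that \<open>a < b\<close> by auto
    from this[of 1] this[of "-1"] show "terminal_hamiltonian D v b d = 0" by simp }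
  have "\<forall>\<^sub>F s in at_right 0. s \<in> {0..1::real}"
    using eventually_at_right_0_less[of 1] by (auto elim: eventually_mono)
  from V[OF _ _ this tendsto_self_divide_at_right_0, of e w 0]
  show "trajectory D a b e w \<Longrightarrow> e a = d a \<Longrightarrow> 0 \<le> path_derivative D v a b d (\<lambda>t. e t - d t)" by simp
qed

text \<open>A positive area needs an interval of positive length and, \<open>d\<close> being
  non-decreasing, a positive value at its right end. The former lets \<open>b\<close> move backward,
  the latter makes \<open>d b\<close> a legitimate divisor.\<close>

lemma area_optimal_trajectory:
  assumes K: "K > 0" and opt: "area_optimal D v a d0 K b d u"
  shows "trajectory D a b d u" "d a \<in> {0..d0}" "integral {a..b} d = K" "a < b" "0 < d b"
proof -
  show d: "trajectory D a b d u" and da: "d a \<in> {0..d0}" and A: "integral {a..b} d = K"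
    using opt unfolding area_optimal_def admissible_iff_trajectory area_def by auto
  show ab: "a < b"
    using trajectoryD(1)[OF d] A K by (cases "a = b") auto
  show "0 < d b"
  proof (rule ccontr)
    assume "\<not> 0 < d b"
    then have "d t \<le> 0" if "t \<in> {a..b}" for t
      using trajectory_increment(1)[OF d, of t b] that by auto
    then have "integral {a..b} d \<le> integral {a..b} (\<lambda>_. 0)"
      by (intro integral_le integrable_continuous_interval trajectory_continuous[OF d]) auto
    with A K show False by simp
  qed
qed

text \<open>The area \<open>\<Delta>\<close> gained in the direction \<open>e - d\<close> must be
  offset by moving the end. To first order
  \<open>\<sigma> * s * d b + \<theta> s * \<Delta> = 0\<close>, so \<open>\<theta> s / s\<close>
  tends to \<open>d b / \<bar>\<Delta>\<bar>\<close> for \<open>\<sigma> = - sgn \<Delta>\<close>.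
  Dividing the variation inequality by this rate turns the contribution of the end into a multiple
  of \<open>\<Delta>\<close>.\<close>

lemma area_optimal_inequality:
  assumes hp: "half_plane D" and v: "Ck_on 2 D v" and pos: "\<forall>(x, y)\<in>D. v x y > 0"
    and K: "K > 0" and opt: "area_optimal D v a d0 K b d u"
    and e: "trajectory D a b e w" and ea: "e a = d a"
  shows "0 \<le> path_derivative D v a b d (\<lambda>t. e t - d t)
    - terminal_hamiltonian D v b d / d b * integral {a..b} (\<lambda>t. e t - d t)"
proof -
  note O = area_optimal_trajectory[OF K opt]
  note d = O(1)
  have min: "cost D v a b d u \<le> cost D v a b' d' u'"
    if "trajectory D a b' d' u'" "d' a = d a" "integral {a..b'} d' = K" for b' d' u'
    using opt that O(2) unfolding area_optimal_def admissible_iff_trajectory area_def by auto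
  define w0 :: real where "w0 = (if logd2 D v b (b - d b) \<ge> 0 then 1 else 0)"
  have w01: "w0 \<in> {0..1}" by (simp add: w0_def)
  let ?d = "extend_path b w0 d" and ?e = "extend_path b w0 e"
  define \<delta> where "\<delta> t = ?e t - ?d t" for t
  define \<Delta> where "\<Delta> = integral {a..b} (\<lambda>t. e t - d t)"
  have \<Delta>: "integral {a..b} \<delta> = \<Delta>"
    unfolding \<Delta>_def \<delta>_def by (rule integral_cong) (simp add: extend_path_def)
  have Kd: "integral {a..b} ?d = K"
    unfolding O(3)[symmetric] by (rule integral_cong) (simp add: extend_path_def)
  have db: "?d b = d b" by (simp add: extend_path_def)
  note V = variation_inequality[OF hp v pos d e ea _ _ _ _ _ w0_def,
      where Q = "\<lambda>b' d'. integral {a..b'} d' = K", OF _ _ _ _ min, folded \<delta>_def]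
  have dc: "continuous_on {a..b + 1} ?d" and ec: "continuous_on {a..b + 1} ?e"
    using trajectory_continuous[OF trajectory_extend[OF hp d w01, of "b + 1"]]
      trajectory_continuous[OF trajectory_extend[OF hp e w01, of "b + 1"]] by auto
  then have \<delta>c: "continuous_on {a..b + 1} \<delta>" unfolding \<delta>_def by (intro continuous_intros)
  have area: "integral {a..c} (\<lambda>t. ?d t + x * \<delta> t) = integral {a..c} ?d + x * integral {a..c} \<delta>"
    if "c \<in> {a..b + 1}" for c x
  proof -
    have "?d integrable_on {a..c}" "\<delta> integrable_on {a..c}"
      by (rule integrable_continuous_interval, rule continuous_on_subset[OF dc], use that in force)
        (rule integrable_continuous_interval, rule continuous_on_subset[OF \<delta>c], use that in force)
    then show ?thesis
      by (subst Henstock_Kurzweil_Integration.integral_add) (auto intro: integrable_on_mult_right)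
  qed
  show ?thesis
  proof (cases "\<Delta> = 0")
    case True
    have "\<forall>\<^sub>F s in at_right 0. s \<in> {0..1::real}"
      using eventually_at_right_0_less[of 1] by (auto elim: eventually_mono)
    \<comment> \<open>A direction that does not change the area can be followed with
      \<open>b\<close> fixed.\<close>
    moreover have "integral {a..b + 0 * s} (\<lambda>t. ?d t + s * \<delta> t) = K" for s :: real
      using area[of b s] O(4) by (simp add: \<Delta> Kd True)
    then have "\<forall>\<^sub>F s in at_right 0. integral {a..b + 0 * s} (\<lambda>t. ?d t + s * \<delta> t) = K"
      by (intro always_eventually allI)
    ultimately have "0 \<le> 0 * terminal_hamiltonian D v b d + 1 * path_derivative D v a b d (\<lambda>t. e t - d t)"
      by (intro V[OF _ tendsto_self_divide_at_right_0]) auto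
    then show ?thesis using True by (simp add: \<Delta>_def)
  next
    case False
    \<comment> \<open>\<open>\<sigma>\<close> is chosen so that the \<open>\<theta>\<close> compensating the change of area is nonnegative\<close>
    define \<sigma> where "\<sigma> = - sgn \<Delta>"
    have \<sigma>: "\<sigma> \<in> {-1, 0, 1}" by (auto simp: \<sigma>_def sgn_if)
    have end_in: "\<forall>\<^sub>F s in at_right 0. b + \<sigma> * s \<in> {a..b + 1}"
      by (rule eventually_end_in) (use O(4) \<sigma> in auto)
    have grow: "((\<lambda>s. (integral {a..b + \<sigma> * s} h - integral {a..b} h) / s) \<longlongrightarrow> \<sigma> * h b) (at_right 0)"
      if "continuous_on {a..b + 1} h" for h
    proof -
      have "continuous_on ({0..1::real} \<times> {a..b + 1}) (\<lambda>z. h (snd z))"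
        by (rule continuous_on_compose2[OF that]) (auto intro!: continuous_intros)
      from integral_variable_end[OF this _ _ \<sigma> end_in, of "\<lambda>_. 0"] O(4) show ?thesis by simp
    qed
    have pos': "\<forall>\<^sub>F s in at_right 0. (0::real) < s" by (simp add: eventually_at_right_less)
    \<comment> \<open>Written as a difference quotient times \<open>s\<close>, so that convergence
      of the moving integral follows from \<open>grow\<close>.\<close>
    have "((\<lambda>s. (integral {a..b + \<sigma> * s} \<delta> - \<Delta>) / s * s + \<Delta>) \<longlongrightarrow> \<sigma> * \<delta> b * 0 + \<Delta>) (at_right 0)"
      using grow[OF \<delta>c] unfolding \<Delta> by (intro tendsto_intros)
    moreover have "\<forall>\<^sub>F s in at_right 0. (integral {a..b + \<sigma> * s} \<delta> - \<Delta>) / s * s + \<Delta> = integral {a..b + \<sigma> * s} \<delta>"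
      using pos' by eventually_elim simp
    ultimately have den: "((\<lambda>s. integral {a..b + \<sigma> * s} \<delta>) \<longlongrightarrow> \<Delta>) (at_right 0)"
      by (simp add: tendsto_cong)
    \<comment> \<open>The exact solution of the area equation, which is affine in
      \<open>\<theta>\<close>; competitors must have area \<open>K\<close>, so a first-order
      solution would not do.\<close>
    define \<theta> where "\<theta> s = - (integral {a..b + \<sigma> * s} ?d - K) / integral {a..b + \<sigma> * s} \<delta>" for s
    define \<kappa> where "\<kappa> = d b / \<bar>\<Delta>\<bar>"
    have \<kappa>0: "\<kappa> > 0" using O(5) False by (simp add: \<kappa>_def)
    have "((\<lambda>s. - ((integral {a..b + \<sigma> * s} ?d - K) / s) / integral {a..b + \<sigma> * s} \<delta>) \<longlongrightarrow> - (\<sigma> * d b) / \<Delta>) (at_right 0)"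
      using grow[OF dc] unfolding Kd db by (intro tendsto_intros den False)
    moreover have "- (\<sigma> * d b) / \<Delta> = \<kappa>" using False by (auto simp: \<sigma>_def \<kappa>_def sgn_if field_simps)
    moreover have "(\<lambda>s. - ((integral {a..b + \<sigma> * s} ?d - K) / s) / integral {a..b + \<sigma> * s} \<delta>) = (\<lambda>s. \<theta> s / s)"
    proof -
      have "- (n / s) / i = - n / i / s" for n s i :: real by (simp add: mult.commute)
      then show ?thesis unfolding \<theta>_def by (intro ext)
    qed
    ultimately have \<kappa>: "((\<lambda>s. \<theta> s / s) \<longlongrightarrow> \<kappa>) (at_right 0)" by simp
    have "\<forall>\<^sub>F s in at_right 0. 0 < \<theta> s / s" "\<forall>\<^sub>F s in at_right 0. \<theta> s / s < \<kappa> + 1"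
      using order_tendstoD[OF \<kappa>] \<kappa>0 by auto
    moreover have "\<forall>\<^sub>F s in at_right 0. 0 < s \<and> s < 1 / (\<kappa> + 1)"
      by (rule eventually_at_right_0_less) (use \<kappa>0 in simp)
    ultimately have \<theta>: "\<forall>\<^sub>F s in at_right 0. \<theta> s \<in> {0..1}"
    proof eventually_elim
      case (elim s)
      then have "\<theta> s < (\<kappa> + 1) * s" "(\<kappa> + 1) * s < 1" "0 < \<theta> s"
        using \<kappa>0 by (simp_all add: field_simps)
      then show ?case by simp
    qed
    have nz: "\<forall>\<^sub>F s in at_right 0. integral {a..b + \<sigma> * s} \<delta> \<noteq> 0"
      by (rule tendsto_imp_eventually_ne[OF den False])
    have Q: "\<forall>\<^sub>F s in at_right 0. integral {a..b + \<sigma> * s} (\<lambda>t. ?d t + \<theta> s * \<delta> t) = K"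
      using nz end_in
    proof eventually_elim
      case (elim s)
      then show ?case unfolding area[OF elim(2)] by (simp add: \<theta>_def)
    qed
    let ?S = "path_derivative D v a b d (\<lambda>t. e t - d t)" and ?h = "terminal_hamiltonian D v b d"
    have "0 \<le> \<sigma> * ?h + \<kappa> * ?S"
      by (rule V[OF \<theta> \<kappa> \<sigma>]) (use O(4) Q in simp_all)
    \<comment> \<open>The factor is \<open>1 / \<kappa>\<close>; it normalizes the coefficient of
      the path derivative to 1.\<close>
    then have "0 \<le> (\<bar>\<Delta>\<bar> / d b) * (\<sigma> * ?h + \<kappa> * ?S)"
      using O(5) by (intro mult_nonneg_nonneg) auto
    also have "\<dots> = ?S - ?h / d b * \<Delta>"
      using O(5) False by (auto simp: \<sigma>_def \<kappa>_def sgn_if field_simps)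
    finally show ?thesis by (simp add: \<Delta>_def)
  qed
qed

section \<open>The minimum principle and the three kinds of arcs\<close>

lemma AE_lebesgue_on_subset:
  assumes "AE t in lebesgue_on {a..b}. Q t" "a \<le> \<alpha>" "\<beta> \<le> (b::real)"
  shows "AE t in lebesgue_on {\<alpha><..<\<beta>}. Q t"
proof -
  have "AE t in lebesgue. t \<in> {a..b} \<longrightarrow> Q t"
    using assms(1) by (simp add: AE_restrict_space_iff)
  then have "AE t in lebesgue. t \<in> {\<alpha><..<\<beta>} \<longrightarrow> Q t"
    by (rule AE_mp) (use assms in \<open>auto intro!: AE_I2\<close>)
  then show ?thesis by (simp add: AE_restrict_space_iff)
qed

text \<open>A nonempty open interval has positive measure. This serves to contradict two
  incompatible values of the control.\<close>

lemma AE_lebesgue_on_ex: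
  assumes "AE t in lebesgue_on {\<alpha><..<\<beta>}. Q t" "\<alpha> < (\<beta>::real)"
  shows "\<exists>t\<in>{\<alpha><..<\<beta>}. Q t"
proof (rule ccontr)
  assume "\<not> (\<exists>t\<in>{\<alpha><..<\<beta>}. Q t)"
  then have "AE t in lebesgue_on {\<alpha><..<\<beta>}. False"
    using assms(1) by (auto simp: AE_restrict_space_iff elim!: eventually_mono)
  then have "ae_filter (lebesgue_on {\<alpha><..<\<beta>}) = bot"
    by (simp only: eventually_False)
  then have "emeasure (lebesgue_on {\<alpha><..<\<beta>}) (space (lebesgue_on {\<alpha><..<\<beta>})) = 0"
    by (simp only: ae_filter_eq_bot_iff)
  then show False using assms(2) by (simp add: emeasure_restrict_space)
qed

lemma has_integral_AE_eq:
  fixes f g :: "real \<Rightarrow> real"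
  assumes AE: "AE t in lebesgue_on {\<alpha><..<\<beta>}. f t = g t" and t: "t \<in> {\<alpha>..\<beta>}"
    and I: "(f has_integral I) {\<alpha>..t}"
  shows "(g has_integral I) {\<alpha>..t}"
proof -
  have "AE t in lebesgue. t \<in> {\<alpha><..<\<beta>} \<longrightarrow> f t = g t"
    using AE by (simp add: AE_restrict_space_iff)
  then obtain N where N: "N \<in> null_sets lebesgue" "{t. \<not> (t \<in> {\<alpha><..<\<beta>} \<longrightarrow> f t = g t)} \<subseteq> N"
    by (auto simp: eventually_ae_filter)
  \<comment> \<open>The hypothesis covers the open interval only, so the endpoints join the
    exceptional set.\<close>
  have "negligible (N \<union> {\<alpha>, \<beta>})"
    using N(1) by (simp add: negligible_iff_null_sets[symmetric])
  then show ?thesis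
  proof (rule has_integral_spike[OF _ _ I])
    fix x assume x: "x \<in> {\<alpha>..t} - (N \<union> {\<alpha>, \<beta>})"
    then have "x \<in> {\<alpha><..<\<beta>}" using t by auto
    then have "f x = g x" using N(2) x by blast
    then show "g x = f x" ..
  qed
qed

text \<open>A single competitor suffices. It minimizes \<open>P t * w\<close> at every
  \<open>t\<close>, so its advantage over \<open>u\<close> is nonnegative; the hypothesis makes the
  integral of this advantage nonpositive, hence it vanishes almost everywhere.\<close>

lemma pointwise_minimum:
  fixes P u :: "real \<Rightarrow> real"
  assumes P: "continuous_on {a..b} P"
    and u: "u \<in> borel_measurable (lebesgue_on {a..b})" "\<And>t. t \<in> {a..b} \<Longrightarrow> u t \<in> {0..1}"
    and min: "\<And>w. w \<in> borel_measurable (lebesgue_on {a..b}) \<Longrightarrow> (\<And>t. t \<in> {a..b} \<Longrightarrow> w t \<in> {0..1})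
      \<Longrightarrow> 0 \<le> integral {a..b} (\<lambda>t. P t * (w t - u t))"
  shows "AE t in lebesgue_on {a..b}. \<forall>w\<in>{0..1}. P t * u t \<le> P t * w"
proof -
  \<comment> \<open>Where \<open>P\<close> vanishes every value is a minimizer; 1 is taken
    there.\<close>
  define w :: "real \<Rightarrow> real" where "w t = (if P t > 0 then 0 else 1)" for t
  have Pm: "P \<in> borel_measurable (lebesgue_on {a..b})"
    by (rule continuous_imp_measurable_on_sets_lebesgue[OF P]) simp
  have wm: "w \<in> borel_measurable (lebesgue_on {a..b})"
    unfolding w_def using Pm by measurable
  define h where "h t = P t * (u t - w t)" for t
  have best: "P t * w t \<le> P t * x" if "x \<in> {0..1}" for t x
    using that by (auto simp: w_def mult_le_cancel_left1)
  have h0: "0 \<le> h t" if "t \<in> {a..b}" for t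
    using best[OF u(2)[OF that], of t] by (simp add: h_def algebra_simps)
  have "h absolutely_integrable_on {a..b}"
    unfolding h_def
  proof (rule integrable_continuous_mult_bounded[OF P])
    show "(\<lambda>t. u t - w t) \<in> borel_measurable (lebesgue_on {a..b})" using u(1) wm by measurable
    show "\<bar>u t - w t\<bar> \<le> 1" if "t \<in> {a..b}" for t using u(2)[OF that] by (auto simp: w_def)
  qed
  then have hi: "integrable (lebesgue_on {a..b}) h"
    by (simp add: integrable_restrict_space set_integrable_def)
  have "0 \<le> integral {a..b} (\<lambda>t. P t * (w t - u t))"
    by (rule min[OF wm]) (simp add: w_def)
  also have "(\<lambda>t. P t * (w t - u t)) = (\<lambda>t. - h t)" by (simp add: h_def fun_eq_iff algebra_simps)
  finally have "integral {a..b} h \<le> 0" by simp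
  moreover have "integral {a..b} h = integral\<^sup>L (lebesgue_on {a..b}) h"
    by (rule lebesgue_integral_eq_integral[OF hi, symmetric]) simp
  moreover have "0 \<le> integral\<^sup>L (lebesgue_on {a..b}) h"
    by (rule Bochner_Integration.integral_nonneg) (use h0 in auto)
  ultimately have "integral\<^sup>L (lebesgue_on {a..b}) h = 0" by simp
  moreover have "AE t in lebesgue_on {a..b}. 0 \<le> h t" by (rule AE_I2) (use h0 in auto)
  ultimately have "AE t in lebesgue_on {a..b}. h t = 0"
    using integral_nonneg_eq_0_iff_AE[OF hi] by simp
  then show ?thesis
  proof eventually_elim
    case (elim t)
    then have "P t * u t = P t * w t" by (simp add: h_def algebra_simps)
    then show ?case using best[of _ t] by presburger
  qed
qed

text \<open>Common ground of both problems: \<open>r\<close> is the multiplier of the area, and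
  without the area constraint the inequality holds with \<open>r = 0\<close>. Inside the locale,
  optimality enters through \<open>variation\<close> alone.\<close>

locale extremal =
  fixes D :: "(real \<times> real) set" and v :: "real \<Rightarrow> real \<Rightarrow> real" and a b :: real
    and d u :: "real \<Rightarrow> real" and r :: real
  assumes hp: "half_plane D" and v: "Ck_on 2 D v" and pos: "\<forall>(x, y)\<in>D. v x y > 0"
    and d: "trajectory D a b d u"
    and variation: "\<And>e w. trajectory D a b e w \<Longrightarrow> e a = d a \<Longrightarrow>
      0 \<le> path_derivative D v a b d (\<lambda>t. e t - d t) + r * integral {a..b} (\<lambda>t. e t - d t)"
begin

text \<open>
  The coefficient of \<open>u\<close> in the Hamiltonian: the costate of \<open>d\<close> when the cost is
  written as \<open>\<integral> \<nu>\<^sub>q dt + log \<nu>\<^sub>q(b, b - d(b))\<close>.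
\<close>

definition switching :: "real \<Rightarrow> real" where
  "switching t = integral {t..b} (\<lambda>s. r - pd2 D v s (s - d s)) - logd2 D v b (b - d b)"

text \<open>Adding \<open>logd2\<close> along the path passes to the cost in its original form,
  whose integrand contains the control. The two terms cancel at \<open>b\<close>.\<close>

definition costate_path :: "real \<Rightarrow> real" where
  "costate_path t = switching t + logd2 D v t (t - d t)"

lemma le: "a \<le> b"
  using trajectoryD(1)[OF d] .

lemma continuous_pd2_along: "continuous_on {a..b} (\<lambda>t. pd2 D v t (t - d t))"
  by (rule continuous_on_along_trajectory[OF d has_partialsD(3)[OF Ck_on_2_has_partials(1)[OF hp v]]])

lemma switching_derivative:
  assumes "t \<in> {a..b}"
  shows "(switching has_real_derivative (pd2 D v t (t - d t) - r)) (at t within {a..b})"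
proof -
  have c: "continuous_on {a..b} (\<lambda>s. r - pd2 D v s (s - d s))"
    by (intro continuous_intros continuous_pd2_along)
  show ?thesis
    unfolding switching_def[abs_def]
    by (rule derivative_eq_intros integral_has_real_derivative'[OF c assms] refl)+ simp
qed

lemma continuous_switching: "continuous_on {a..b} switching"
  by (rule DERIV_continuous_on[OF switching_derivative])

lemma switching_increment:
  assumes "a \<le> \<alpha>" "\<alpha> \<le> t" "t \<le> b"
  shows "((\<lambda>s. pd2 D v s (s - d s) - r) has_integral (switching t - switching \<alpha>)) {\<alpha>..t}"
proof (rule fundamental_theorem_of_calculus[OF assms(2)])
  fix s assume "s \<in> {\<alpha>..t}"
  then have "(switching has_real_derivative (pd2 D v s (s - d s) - r)) (at s within {\<alpha>..t})"
    using assms by (intro DERIV_subset[OF switching_derivative]) auto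
  then show "(switching has_vector_derivative (pd2 D v s (s - d s) - r)) (at s within {\<alpha>..t})"
    by (simp add: has_real_derivative_iff_has_vector_derivative)
qed

text \<open>The switching function contributes \<open>pd2 D v - r\<close>, and the chain rule for
  \<open>logd2\<close> contributes a term with the factor \<open>1 - u\<close>;
  \<open>pd2_running\<close> turns the sum into the right-hand side of the costate equation.\<close>

lemma costate_costate_path: "costate D v a b d u costate_path r"
  unfolding costate_def
proof
  fix t assume t: "t \<in> {a..b}"
  have "((\<lambda>s. (pd2 D v s (s - d s) - r) + (pd1 D (logd2 D v) s (s - d s) + pd2 D (logd2 D v) s (s - d s) * (1 - u s)))
      has_integral ((switching t - switching a) + (logd2 D v t (t - d t) - logd2 D v a (a - d a)))) {a..t}"
    using switching_increment[of a t] integral_along_trajectory[OF d has_partials_logd2[OF hp v pos] t] t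
    by (intro has_integral_add) auto
  moreover have "(pd2 D v s (s - d s) - r) + (pd1 D (logd2 D v) s (s - d s) + pd2 D (logd2 D v) s (s - d s) * (1 - u s)) =
      pd2 D (running D v) s (s - d s) - pd2 D (logd2 D v) s (s - d s) * u s - r" if "s \<in> {a..t}" for s
    using pd2_running[OF hp v pos trajectoryD(5)[OF d, of s]] that t by (simp add: algebra_simps)
  ultimately have "((\<lambda>s. pd2 D (running D v) s (s - d s) - pd2 D (logd2 D v) s (s - d s) * u s - r)
      has_integral ((switching t - switching a) + (logd2 D v t (t - d t) - logd2 D v a (a - d a)))) {a..t}"
    by (rule has_integral_eq[rotated])
  then show "((\<lambda>s. pd2 D (running D v) s (s - d s) - pd2 D (logd2 D v) s (s - d s) * u s - r)
      has_integral (costate_path t - costate_path a)) {a..t}"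
    by (simp add: costate_path_def algebra_simps)
qed

lemma costate_path_end: "costate_path b = 0"
  by (simp add: costate_path_def switching_def)

lemma switching_minimum: "AE t in lebesgue_on {a..b}. \<forall>w\<in>{0..1}. switching t * u t \<le> switching t * w"
proof (rule pointwise_minimum[OF continuous_switching trajectoryD(2)[OF d] trajectoryD(3)[OF d]])
  fix w :: "real \<Rightarrow> real"
  assume w: "w \<in> borel_measurable (lebesgue_on {a..b})" "\<And>t. t \<in> {a..b} \<Longrightarrow> w t \<in> {0..1}"
  define e where "e t = d a + integral {a..t} w" for t
  have aD: "(a, a - d a) \<in> D" using trajectoryD(5)[OF d, of a] le by simp
  have e: "trajectory D a b e w"
    unfolding e_def by (rule trajectory_of_control[OF hp le aD w])
  have ea: "e a = d a" by (simp add: e_def)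
  have c: "continuous_on {a..b} (\<lambda>t. pd2 D v t (t - d t) - r)"
    by (intro continuous_intros continuous_pd2_along)
  have c2: "continuous_on {a..b} (\<lambda>t. e t - d t)"
    by (intro continuous_intros trajectory_continuous[OF d] trajectory_continuous[OF e])
  have "((\<lambda>t. ((pd2 D v t (t - d t) - r) * e t + switching t * w t) - ((pd2 D v t (t - d t) - r) * d t + switching t * u t))
      has_integral ((switching b * e b - switching a * e a) - (switching b * d b - switching a * d a))) {a..b}"
    by (intro has_integral_diff trajectory_integration_by_parts[OF e switching_derivative c]
        trajectory_integration_by_parts[OF d switching_derivative c])
  moreover have "((\<lambda>t. (pd2 D v t (t - d t) * (e t - d t)) - r * (e t - d t)) has_integral
      (integral {a..b} (\<lambda>t. pd2 D v t (t - d t) * (e t - d t)) - r * integral {a..b} (\<lambda>t. e t - d t))) {a..b}"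
    by (intro has_integral_diff has_integral_mult_right integrable_integral integrable_continuous_interval
        continuous_on_mult continuous_pd2_along c2)
  ultimately have "((\<lambda>t. (((pd2 D v t (t - d t) - r) * e t + switching t * w t) - ((pd2 D v t (t - d t) - r) * d t + switching t * u t))
      - ((pd2 D v t (t - d t) * (e t - d t)) - r * (e t - d t))) has_integral
      (((switching b * e b - switching a * e a) - (switching b * d b - switching a * d a)) -
       (integral {a..b} (\<lambda>t. pd2 D v t (t - d t) * (e t - d t)) - r * integral {a..b} (\<lambda>t. e t - d t)))) {a..b}"
    by (rule has_integral_diff)
  \<comment> \<open>The boundary term at \<open>a\<close> vanishes because \<open>e a = d a\<close>;
    the one at \<open>b\<close> is the terminal part of \<open>path_derivative\<close>, by the value
    of \<open>switching b\<close>.\<close>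
  then have "integral {a..b} (\<lambda>t. switching t * (w t - u t)) =
      path_derivative D v a b d (\<lambda>t. e t - d t) + r * integral {a..b} (\<lambda>t. e t - d t)"
    by (intro integral_unique) (simp add: ea path_derivative_def switching_def algebra_simps)
  then show "0 \<le> integral {a..b} (\<lambda>t. switching t * (w t - u t))"
    using variation[OF e ea] by simp
qed

lemma minimum_principle_costate_path: "minimum_principle D v a b d u costate_path r"
  unfolding minimum_principle_def hamiltonian_def
  using switching_minimum by eventually_elim (simp add: costate_path_def)

lemma switching_minimum_on:
  assumes "a \<le> \<alpha>" "\<beta> \<le> b"
  shows "AE t in lebesgue_on {\<alpha><..<\<beta>}. u t \<in> {0..1} \<and> (\<forall>w\<in>{0..1}. switching t * u t \<le> switching t * w)"
proof (rule AE_lebesgue_on_subset[OF _ assms])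
  have "AE t in lebesgue_on {a..b}. u t \<in> {0..1}"
    by (rule AE_I2) (use trajectoryD(3)[OF d] in auto)
  with switching_minimum show
    "AE t in lebesgue_on {a..b}. u t \<in> {0..1} \<and> (\<forall>w\<in>{0..1}. switching t * u t \<le> switching t * w)"
    by eventually_elim simp
qed

section \<open>The sign of the switching function and the value of the control\<close>

lemma control_off:
  assumes ab: "a \<le> \<alpha>" "\<beta> \<le> b" and p: "\<And>t. t \<in> {\<alpha><..<\<beta>} \<Longrightarrow> switching t > 0"
  shows "AE t in lebesgue_on {\<alpha><..<\<beta>}. u t = 0"
proof -
  have "AE t in lebesgue_on {\<alpha><..<\<beta>}. switching t > 0" by (rule AE_I2) (use p in auto)
  with switching_minimum_on[OF ab] show ?thesis
  proof eventually_elim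
    case (elim t)
    then have "switching t * u t \<le> switching t * 0" by (meson atLeastAtMost_iff order_refl zero_le_one)
    then show ?case using elim by (auto simp: mult_le_0_iff)
  qed
qed

lemma control_on:
  assumes ab: "a \<le> \<alpha>" "\<beta> \<le> b" and p: "\<And>t. t \<in> {\<alpha><..<\<beta>} \<Longrightarrow> switching t < 0"
  shows "AE t in lebesgue_on {\<alpha><..<\<beta>}. u t = 1"
proof -
  have "AE t in lebesgue_on {\<alpha><..<\<beta>}. switching t < 0" by (rule AE_I2) (use p in auto)
  with switching_minimum_on[OF ab] show ?thesis
  proof eventually_elim
    case (elim t)
    then have "switching t * u t \<le> switching t * 1" by (meson atLeastAtMost_iff order_refl zero_le_one)
    then show ?case using elim by auto
  qed
qed

text \<open>The factor \<open>s\<close> carries a sign, so that one lemma serves positive and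
  negative values.\<close>

lemma switching_sign_near:
  assumes ab: "a \<le> \<alpha>" "\<beta> \<le> b" and t: "t \<in> {\<alpha><..<\<beta>}" and nz: "s * switching t > 0"
  shows "\<exists>\<alpha>' \<beta>'. \<alpha> \<le> \<alpha>' \<and> \<alpha>' < \<beta>' \<and> \<beta>' \<le> \<beta> \<and> (\<forall>x\<in>{\<alpha>'<..<\<beta>'}. s * switching x > 0)"
proof -
  have "continuous (at t within {a..b}) (\<lambda>x. s * switching x)"
    using continuous_switching ab t by (auto simp: continuous_on_eq_continuous_within intro!: continuous_intros)
  then obtain \<delta> where \<delta>: "\<delta> > 0" "\<And>x. x \<in> {a..b} \<Longrightarrow> dist x t < \<delta> \<Longrightarrow> dist (s * switching x) (s * switching t) < s * switching t"
    unfolding continuous_within_eps_delta using nz by blast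
  show ?thesis
  proof (intro exI conjI ballI)
    fix x assume x: "x \<in> {max \<alpha> (t - \<delta>)<..<min \<beta> (t + \<delta>)}"
    then have "dist (s * switching x) (s * switching t) < s * switching t"
      using ab by (intro \<delta>(2)) (auto simp: dist_real_def)
    then show "s * switching x > 0" by (auto simp: dist_real_def)
  qed (use t \<delta>(1) in auto)
qed

text \<open>Were \<open>switching\<close> negative at \<open>t\<close>, it would be so nearby and
  force \<open>u = 1\<close> on an interval of positive length. The inequality is weak, since the
  minimum principle leaves the control undetermined where \<open>switching\<close> vanishes.\<close>

lemma switching_nonneg_if_control_off:
  assumes ab: "a \<le> \<alpha>" "\<beta> \<le> b" and u: "AE t in lebesgue_on {\<alpha><..<\<beta>}. u t = 0" and t: "t \<in> {\<alpha><..<\<beta>}"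
  shows "switching t \<ge> 0"
proof (rule ccontr)
  assume "\<not> switching t \<ge> 0"
  then obtain \<alpha>' \<beta>' where I: "\<alpha> \<le> \<alpha>'" "\<alpha>' < \<beta>'" "\<beta>' \<le> \<beta>" "\<And>x. x \<in> {\<alpha>'<..<\<beta>'} \<Longrightarrow> switching x < 0"
    using switching_sign_near[OF ab t, of "-1"] by auto
  have "AE t in lebesgue_on {\<alpha>'<..<\<beta>'}. u t = 1"
    by (rule control_on) (use I ab in auto)
  moreover have "AE t in lebesgue_on {\<alpha>'<..<\<beta>'}. u t = 0"
    using u I(1,3) by (auto simp: AE_restrict_space_iff elim!: eventually_mono)
  ultimately have "AE t in lebesgue_on {\<alpha>'<..<\<beta>'}. False" by eventually_elim simp
  from AE_lebesgue_on_ex[OF this I(2)] show False by simp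
qed

lemma switching_nonpos_if_control_on:
  assumes ab: "a \<le> \<alpha>" "\<beta> \<le> b" and u: "AE t in lebesgue_on {\<alpha><..<\<beta>}. u t = 1" and t: "t \<in> {\<alpha><..<\<beta>}"
  shows "switching t \<le> 0"
proof (rule ccontr)
  assume "\<not> switching t \<le> 0"
  then obtain \<alpha>' \<beta>' where I: "\<alpha> \<le> \<alpha>'" "\<alpha>' < \<beta>'" "\<beta>' \<le> \<beta>" "\<And>x. x \<in> {\<alpha>'<..<\<beta>'} \<Longrightarrow> switching x > 0"
    using switching_sign_near[OF ab t, of "1"] by auto
  have "AE t in lebesgue_on {\<alpha>'<..<\<beta>'}. u t = 0"
    by (rule control_off) (use I ab in auto)
  moreover have "AE t in lebesgue_on {\<alpha>'<..<\<beta>'}. u t = 1"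
    using u I(1,3) by (auto simp: AE_restrict_space_iff elim!: eventually_mono)
  ultimately have "AE t in lebesgue_on {\<alpha>'<..<\<beta>'}. False" by eventually_elim simp
  from AE_lebesgue_on_ex[OF this I(2)] show False by simp
qed

lemma path_if_control_constant:
  assumes ab: "a \<le> \<alpha>" "\<beta> \<le> b" and u: "AE t in lebesgue_on {\<alpha><..<\<beta>}. u t = k" and t: "t \<in> {\<alpha>..\<beta>}"
  shows "d t = d \<alpha> + k * (t - \<alpha>)"
proof -
  have "(u has_integral (d t - d \<alpha>)) {\<alpha>..t}" by (rule trajectory_integral[OF d]) (use ab t in auto)
  from has_integral_AE_eq[OF u t this] have "((\<lambda>_. k) has_integral (d t - d \<alpha>)) {\<alpha>..t}" .
  moreover have "((\<lambda>_. k) has_integral (k * (t - \<alpha>))) {\<alpha>..t}"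
    using has_integral_const_real[of k \<alpha> t] t by (simp add: mult.commute)
  ultimately have "d t - d \<alpha> = k * (t - \<alpha>)" by (rule has_integral_unique)
  then show ?thesis by simp
qed

text \<open>The costate equation is integrated from \<open>\<alpha>\<close> instead of
  \<open>a\<close>; the term with \<open>u\<close> vanishes almost everywhere and \<open>d\<close>
  is frozen.\<close>

lemma costate_if_control_off:
  assumes ab: "a \<le> \<alpha>" "\<beta> \<le> b" and u: "AE t in lebesgue_on {\<alpha><..<\<beta>}. u t = 0" and t: "t \<in> {\<alpha>..\<beta>}"
  shows "costate_path t = costate_constant D v d costate_path r \<alpha> t"
proof -
  let ?R = "\<lambda>s. pd2 D (running D v) s (s - d s)" and ?L = "\<lambda>s. pd2 D (logd2 D v) s (s - d s)"
  have I: "((\<lambda>s. ?R s - ?L s * u s - r) has_integral (costate_path x - costate_path a)) {a..x}" if "x \<in> {a..b}" for x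
    using costate_costate_path that unfolding costate_def by blast
  have i: "(\<lambda>s. ?R s - ?L s * u s - r) integrable_on {a..t}"
    using I[of t] ab t by auto
  then have "(\<lambda>s. ?R s - ?L s * u s - r) integrable_on {\<alpha>..t}"
    by (rule integrable_subinterval_real) (use ab t in auto)
  moreover have "integral {a..\<alpha>} (\<lambda>s. ?R s - ?L s * u s - r) + integral {\<alpha>..t} (\<lambda>s. ?R s - ?L s * u s - r) =
      integral {a..t} (\<lambda>s. ?R s - ?L s * u s - r)"
    by (rule Henstock_Kurzweil_Integration.integral_combine[OF _ _ i]) (use ab t in auto)
  then have "integral {\<alpha>..t} (\<lambda>s. ?R s - ?L s * u s - r) = costate_path t - costate_path \<alpha>"
    using I[of \<alpha>, THEN integral_unique] I[of t, THEN integral_unique] ab t by auto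
  ultimately have J: "((\<lambda>s. ?R s - ?L s * u s - r) has_integral (costate_path t - costate_path \<alpha>)) {\<alpha>..t}"
    by (metis integrable_integral)
  have "AE s in lebesgue_on {\<alpha><..<\<beta>}. ?R s - ?L s * u s - r = ?R s - r"
    using u by eventually_elim simp
  from has_integral_AE_eq[OF this t J]
  have "((\<lambda>s. ?R s - r) has_integral (costate_path t - costate_path \<alpha>)) {\<alpha>..t}" .
  from has_integral_add[OF this has_integral_const_real[of r \<alpha> t]] t
  have "(?R has_integral (costate_path t - costate_path \<alpha> + r * (t - \<alpha>))) {\<alpha>..t}"
    by (simp add: mult.commute)
  then have "((\<lambda>s. pd2 D (running D v) s (s - d \<alpha>)) has_integral (costate_path t - costate_path \<alpha> + r * (t - \<alpha>))) {\<alpha>..t}"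
  proof (rule has_integral_eq[rotated])
    fix x assume "x \<in> {\<alpha>..t}"
    then have "d x = d \<alpha>" using path_if_control_constant[OF ab u, of x] t by simp
    then show "?R x = pd2 D (running D v) x (x - d \<alpha>)" by (simp only:)
  qed
  then show ?thesis
    unfolding costate_constant_def by (simp add: integral_unique)
qed

text \<open>Here \<open>t - d t\<close> is constant, so the increment of \<open>switching\<close>
  integrates \<open>pd2 D v\<close> at a fixed second argument; adding \<open>logd2\<close> back at
  both ends gives its increment.\<close>

lemma costate_if_control_on:
  assumes ab: "a \<le> \<alpha>" "\<beta> \<le> b" and u: "AE t in lebesgue_on {\<alpha><..<\<beta>}. u t = 1" and t: "t \<in> {\<alpha>..\<beta>}"
  shows "costate_path t = costate_full_slope D v d costate_path r \<alpha> t"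
proof -
  have s: "s - d s = \<alpha> - d \<alpha>" if "s \<in> {\<alpha>..\<beta>}" for s
    using path_if_control_constant[OF ab u that] by simp
  have "((\<lambda>s. pd2 D v s (s - d s) - r) has_integral (switching t - switching \<alpha>)) {\<alpha>..t}"
    by (rule switching_increment) (use ab t in auto)
  from has_integral_add[OF this has_integral_const_real[of r \<alpha> t]] t
  have "((\<lambda>s. pd2 D v s (s - d s)) has_integral (switching t - switching \<alpha> + r * (t - \<alpha>))) {\<alpha>..t}"
    by (simp add: mult.commute)
  then have "((\<lambda>s. pd2 D v s (\<alpha> - d \<alpha>)) has_integral (switching t - switching \<alpha> + r * (t - \<alpha>))) {\<alpha>..t}"
  proof (rule has_integral_eq[rotated])
    fix x assume "x \<in> {\<alpha>..t}"
    then show "pd2 D v x (x - d x) = pd2 D v x (\<alpha> - d \<alpha>)" using s[of x] t by simp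
  qed
  then show ?thesis
    unfolding costate_full_slope_def costate_path_def using s[OF t] by (simp add: integral_unique)
qed

text \<open>A function that vanishes on an open interval has derivative 0 there; continuity carries
  the resulting equation to the endpoints.\<close>

lemma structure_equation:
  assumes ab: "a \<le> \<alpha>" "\<alpha> < \<beta>" "\<beta> \<le> b" and z: "\<And>t. t \<in> {\<alpha><..<\<beta>} \<Longrightarrow> switching t = 0" and t: "t \<in> {\<alpha>..\<beta>}"
  shows "pd2 D v t (t - d t) = r"
proof (rule continuous_constant_on_closure[of "{\<alpha><..<\<beta>}" "\<lambda>t. pd2 D v t (t - d t)"])
  show "continuous_on (closure {\<alpha><..<\<beta>}) (\<lambda>t. pd2 D v t (t - d t))"
    using ab by (auto intro: continuous_on_subset[OF continuous_pd2_along])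
  show "t \<in> closure {\<alpha><..<\<beta>}" using ab t by simp
  fix x assume x: "x \<in> {\<alpha><..<\<beta>}"
  have "(switching has_real_derivative (pd2 D v x (x - d x) - r)) (at x)"
    using switching_derivative[of x] x ab by (simp add: at_within_Icc_at)
  moreover have "(switching has_real_derivative 0) (at x)"
    by (rule has_field_derivative_transform_within_open[of "\<lambda>_. 0" _ _ "{\<alpha><..<\<beta>}"]) (use x z in auto)
  ultimately have "pd2 D v x (x - d x) - r = 0" by (rule DERIV_unique)
  then show "pd2 D v x (x - d x) = r" by simp
qed

text \<open>As \<open>costate_path b = 0\<close>, the Hamiltonian at \<open>b\<close> is affine in
  the control with slope \<open>- logd2\<close>. Its minimum is attained at 1 or 0 according to the
  sign, which is the origin of \<open>max 0\<close> in \<open>terminal_hamiltonian\<close>.\<close>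

lemma min_hamiltonian_end:
  "min_hamiltonian D v b (d b) e (costate_path b) r = terminal_hamiltonian D v b d + r * d b"
proof -
  let ?L = "logd2 D v b (b - d b)" and ?R = "running D v b (b - d b)"
  have "(INF w\<in>{0..1}. ?R + (0 - ?L) * w + r * d b) = ?R - max 0 ?L + r * d b"
  proof (rule cInf_eq_minimum)
    show "?R - max 0 ?L + r * d b \<in> (\<lambda>w. ?R + (0 - ?L) * w + r * d b) ` {0..1}"
      by (rule image_eqI[of _ _ "if ?L \<ge> 0 then 1 else 0"]) auto
    show "?R - max 0 ?L + r * d b \<le> y" if "y \<in> (\<lambda>w. ?R + (0 - ?L) * w + r * d b) ` {0..1}" for y
    proof -
      from that obtain w where w: "w \<in> {0..1}" and y: "y = ?R + (0 - ?L) * w + r * d b" by blast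
      have "?L * w \<le> max 0 ?L * w" using w by (intro mult_right_mono) auto
      also have "\<dots> \<le> max 0 ?L * 1" using w by (intro mult_left_mono) auto
      finally show ?thesis unfolding y by simp
    qed
  qed
  then show ?thesis
    unfolding min_hamiltonian_def hamiltonian_def terminal_hamiltonian_def costate_path_end by simp
qed

section \<open>Classification of the arcs\<close>

lemma constant_arc_iff:
  "constant_arc D v d u costate_path \<alpha> \<beta> \<longleftrightarrow>
    (AE t in lebesgue_on {\<alpha><..<\<beta>}. u t = 0) \<and> (\<forall>t\<in>{\<alpha><..<\<beta>}. switching t > 0)"
  unfolding constant_arc_def by (simp add: costate_path_def)

lemma singular_arc_iff:
  "singular_arc D v d costate_path \<alpha> \<beta> \<longleftrightarrow> (\<forall>t\<in>{\<alpha><..<\<beta>}. switching t = 0)"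
  unfolding singular_arc_def by (simp add: costate_path_def)

lemma full_slope_arc_iff:
  "full_slope_arc D v d u costate_path \<alpha> \<beta> \<longleftrightarrow>
    (AE t in lebesgue_on {\<alpha><..<\<beta>}. u t = 1) \<and> (\<forall>t\<in>{\<alpha><..<\<beta>}. switching t \<le> 0)"
  unfolding full_slope_arc_def by (simp add: costate_path_def)

text \<open>The zero set of a continuous function can be complicated, so the interval is not
  partitioned. Either \<open>switching\<close> vanishes throughout, or it is nonzero at some point
  and keeps its sign nearby.\<close>

lemma ex_arc:
  assumes ab: "a \<le> \<alpha>" "\<alpha> < \<beta>" "\<beta> \<le> b"
  shows "\<exists>\<alpha>' \<beta>'. \<alpha> \<le> \<alpha>' \<and> \<alpha>' < \<beta>' \<and> \<beta>' \<le> \<beta> \<and>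
    (constant_arc D v d u costate_path \<alpha>' \<beta>' \<or> singular_arc D v d costate_path \<alpha>' \<beta>' \<or>
     full_slope_arc D v d u costate_path \<alpha>' \<beta>')"
proof (cases "\<forall>t\<in>{\<alpha><..<\<beta>}. switching t = 0")
  case True
  then show ?thesis using ab singular_arc_iff by blast
next
  case False
  then obtain t where t: "t \<in> {\<alpha><..<\<beta>}" "switching t \<noteq> 0" by blast
  then have "sgn (switching t) * switching t > 0" by (simp add: sgn_if)
  from switching_sign_near[OF ab(1,3) t(1) this] obtain \<alpha>' \<beta>' where I: "\<alpha> \<le> \<alpha>'" "\<alpha>' < \<beta>'" "\<beta>' \<le> \<beta>"
    and S: "\<And>x. x \<in> {\<alpha>'<..<\<beta>'} \<Longrightarrow> sgn (switching t) * switching x > 0" by blast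
  have I': "a \<le> \<alpha>'" "\<beta>' \<le> b" using I ab by auto
  show ?thesis
  proof (cases "switching t > 0")
    case True
    then have "\<And>x. x \<in> {\<alpha>'<..<\<beta>'} \<Longrightarrow> switching x > 0" using S by simp
    then have "constant_arc D v d u costate_path \<alpha>' \<beta>'"
      using control_off[OF I'] by (simp add: constant_arc_iff)
    then show ?thesis using I by blast
  next
    case False
    then have "\<And>x. x \<in> {\<alpha>'<..<\<beta>'} \<Longrightarrow> switching x < 0" using S t(2) by (simp add: sgn_if)
    then have "full_slope_arc D v d u costate_path \<alpha>' \<beta>'"
      using control_on[OF I'] by (simp add: full_slope_arc_iff less_imp_le)
    then show ?thesis using I by blast
  qed
qed

text \<open>A strict sign of \<open>switching\<close> fixes the control, whereas the control fixes
  only a weak sign. The strict inequality on a constant arc is part of the definition of such an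
  arc.\<close>

lemma arcs:
  assumes ab: "a \<le> \<alpha>" "\<alpha> < \<beta>" "\<beta> \<le> b"
  shows "((\<forall>t\<in>{\<alpha><..<\<beta>}. costate_path t > logd2 D v t (t - d t)) \<longrightarrow> constant_arc D v d u costate_path \<alpha> \<beta>) \<and>
    ((\<forall>t\<in>{\<alpha><..<\<beta>}. costate_path t < logd2 D v t (t - d t)) \<longrightarrow> full_slope_arc D v d u costate_path \<alpha> \<beta>) \<and>
    ((AE t in lebesgue_on {\<alpha><..<\<beta>}. u t = 0) \<longrightarrow>
       (\<forall>t\<in>{\<alpha>..\<beta>}. d t = d \<alpha>) \<and>
       (\<forall>t\<in>{\<alpha><..<\<beta>}. costate_path t = costate_constant D v d costate_path r \<alpha> t \<and>
          costate_constant D v d costate_path r \<alpha> t \<ge> logd2 D v t (t - d \<alpha>))) \<and>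
    (constant_arc D v d u costate_path \<alpha> \<beta> \<longrightarrow>
       (\<forall>t\<in>{\<alpha>..\<beta>}. d t = d \<alpha>) \<and>
       (\<forall>t\<in>{\<alpha><..<\<beta>}. costate_path t = costate_constant D v d costate_path r \<alpha> t \<and>
          costate_constant D v d costate_path r \<alpha> t > logd2 D v t (t - d \<alpha>))) \<and>
    (singular_arc D v d costate_path \<alpha> \<beta> \<longrightarrow> (\<forall>t\<in>{\<alpha>..\<beta>}. pd2 D v t (t - d t) = r)) \<and>
    ((AE t in lebesgue_on {\<alpha><..<\<beta>}. u t = 1) \<longrightarrow>
       (\<forall>t\<in>{\<alpha>..\<beta>}. d t = d \<alpha> + (t - \<alpha>)) \<and>
       (\<forall>t\<in>{\<alpha><..<\<beta>}. costate_path t = costate_full_slope D v d costate_path r \<alpha> t \<and>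
          costate_full_slope D v d costate_path r \<alpha> t \<le> logd2 D v t (\<alpha> - d \<alpha>)))"
proof -
  note ab' = ab(1,3)
  have inner: "t \<in> {\<alpha>..\<beta>}" if "t \<in> {\<alpha><..<\<beta>}" for t using that by simp
  have off_path: "\<forall>t\<in>{\<alpha>..\<beta>}. d t = d \<alpha>" if u: "AE t in lebesgue_on {\<alpha><..<\<beta>}. u t = 0"
  proof
    fix t assume "t \<in> {\<alpha>..\<beta>}"
    from path_if_control_constant[OF ab' u this] show "d t = d \<alpha>" by simp
  qed
  have off: "costate_path t = costate_constant D v d costate_path r \<alpha> t"
      "costate_constant D v d costate_path r \<alpha> t = switching t + logd2 D v t (t - d \<alpha>)" "0 \<le> switching t"
    if u: "AE t in lebesgue_on {\<alpha><..<\<beta>}. u t = 0" and t: "t \<in> {\<alpha><..<\<beta>}" for t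
  proof -
    show c: "costate_path t = costate_constant D v d costate_path r \<alpha> t"
      by (rule costate_if_control_off[OF ab' u inner[OF t]])
    have "d t = d \<alpha>" using off_path[OF u] inner[OF t] by blast
    then show "costate_constant D v d costate_path r \<alpha> t = switching t + logd2 D v t (t - d \<alpha>)"
      unfolding c[symmetric] costate_path_def by (simp only:)
    show "0 \<le> switching t" by (rule switching_nonneg_if_control_off[OF ab' u t])
  qed
  have on_path: "\<forall>t\<in>{\<alpha>..\<beta>}. d t = d \<alpha> + (t - \<alpha>)" if u: "AE t in lebesgue_on {\<alpha><..<\<beta>}. u t = 1"
  proof
    fix t assume "t \<in> {\<alpha>..\<beta>}"
    from path_if_control_constant[OF ab' u this] show "d t = d \<alpha> + (t - \<alpha>)" by simp
  qed
  have on: "costate_path t = costate_full_slope D v d costate_path r \<alpha> t"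
      "costate_full_slope D v d costate_path r \<alpha> t = switching t + logd2 D v t (\<alpha> - d \<alpha>)" "switching t \<le> 0"
    if u: "AE t in lebesgue_on {\<alpha><..<\<beta>}. u t = 1" and t: "t \<in> {\<alpha><..<\<beta>}" for t
  proof -
    show c: "costate_path t = costate_full_slope D v d costate_path r \<alpha> t"
      by (rule costate_if_control_on[OF ab' u inner[OF t]])
    have "d t = d \<alpha> + (t - \<alpha>)" using on_path[OF u] inner[OF t] by blast
    then have "t - d t = \<alpha> - d \<alpha>" by linarith
    then show "costate_full_slope D v d costate_path r \<alpha> t = switching t + logd2 D v t (\<alpha> - d \<alpha>)"
      unfolding c[symmetric] costate_path_def by (simp only:)
    show "switching t \<le> 0" by (rule switching_nonpos_if_control_on[OF ab' u t])
  qed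
  show ?thesis
  proof (intro conjI)
    show "(\<forall>t\<in>{\<alpha><..<\<beta>}. costate_path t > logd2 D v t (t - d t)) \<longrightarrow> constant_arc D v d u costate_path \<alpha> \<beta>"
      using control_off[OF ab'] by (simp add: constant_arc_iff costate_path_def)
    show "(\<forall>t\<in>{\<alpha><..<\<beta>}. costate_path t < logd2 D v t (t - d t)) \<longrightarrow> full_slope_arc D v d u costate_path \<alpha> \<beta>"
      using control_on[OF ab'] by (simp add: full_slope_arc_iff costate_path_def less_imp_le)
    show "singular_arc D v d costate_path \<alpha> \<beta> \<longrightarrow> (\<forall>t\<in>{\<alpha>..\<beta>}. pd2 D v t (t - d t) = r)"
      using structure_equation[OF ab] by (simp add: singular_arc_iff)
    show "(AE t in lebesgue_on {\<alpha><..<\<beta>}. u t = 0) \<longrightarrow>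
       (\<forall>t\<in>{\<alpha>..\<beta>}. d t = d \<alpha>) \<and>
       (\<forall>t\<in>{\<alpha><..<\<beta>}. costate_path t = costate_constant D v d costate_path r \<alpha> t \<and>
          costate_constant D v d costate_path r \<alpha> t \<ge> logd2 D v t (t - d \<alpha>))"
      by (intro impI conjI ballI off_path off(1)) (simp_all add: off(2,3))
    show "constant_arc D v d u costate_path \<alpha> \<beta> \<longrightarrow>
       (\<forall>t\<in>{\<alpha>..\<beta>}. d t = d \<alpha>) \<and>
       (\<forall>t\<in>{\<alpha><..<\<beta>}. costate_path t = costate_constant D v d costate_path r \<alpha> t \<and>
          costate_constant D v d costate_path r \<alpha> t > logd2 D v t (t - d \<alpha>))"
      unfolding constant_arc_iff
      by (intro impI conjI ballI off_path off(1); elim conjE) (simp_all add: off(2))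
    show "(AE t in lebesgue_on {\<alpha><..<\<beta>}. u t = 1) \<longrightarrow>
       (\<forall>t\<in>{\<alpha>..\<beta>}. d t = d \<alpha> + (t - \<alpha>)) \<and>
       (\<forall>t\<in>{\<alpha><..<\<beta>}. costate_path t = costate_full_slope D v d costate_path r \<alpha> t \<and>
          costate_full_slope D v d costate_path r \<alpha> t \<le> logd2 D v t (\<alpha> - d \<alpha>))"
      by (intro impI conjI ballI on_path on(1)) (simp_all add: on(2,3))
  qed
qed

end

text \<open>The multiplier is the rate at which area is exchanged for cost at the free end, with the
  sign that makes the Hamiltonian vanish there.\<close>

lemma extremal_area_optimal:
  assumes hp: "half_plane D" and v: "Ck_on 2 D v" and pos: "\<forall>(x, y)\<in>D. v x y > 0"
    and K: "K > 0" and opt: "area_optimal D v a d0 K b d u"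
  shows "extremal D v a b d u (- terminal_hamiltonian D v b d / d b)"
proof (rule extremal.intro[OF hp v pos area_optimal_trajectory(1)[OF K opt]])
  fix e w assume "trajectory D a b e w" "e a = d a"
  from area_optimal_inequality[OF hp v pos K opt this]
  show "0 \<le> path_derivative D v a b d (\<lambda>t. e t - d t) +
      - terminal_hamiltonian D v b d / d b * integral {a..b} (\<lambda>t. e t - d t)" by simp
qed

lemma extremal_optimal:
  assumes hp: "half_plane D" and v: "Ck_on 2 D v" and pos: "\<forall>(x, y)\<in>D. v x y > 0"
    and opt: "optimal D v a d0 b d u"
  shows "extremal D v a b d u 0"
  by (rule extremal.intro[OF hp v pos])
    (use opt optimal_inequality(2)[OF hp v pos opt] in \<open>auto simp: optimal_def admissible_iff_trajectory\<close>)

theorem theorem1: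
  fixes M :: "'w measure" and F :: "real \<Rightarrow> 'w measure"
    and P :: "real \<Rightarrow> 'w measure" and X :: "real \<Rightarrow> 'w \<Rightarrow> real"
    and q a d0 K :: real and D :: "(real \<times> real) set" and v :: "real \<Rightarrow> real \<Rightarrow> real"
  assumes "spectrally_negative_strong_markov M F P X"
    and "q > 0" and "a \<ge> 0" and "K > 0" and "d0 \<ge> 0"
    and "D = {(x, y). y \<le> x} \<or> D = {(x, y). y < x}"
    and "is_nu P X q D v"
    and "\<forall>(x, y)\<in>D. v x y > 0"
    and "Ck_on 2 D v"
  shows
    "(\<forall>b d u.
        area_optimal D v a d0 K b d u \<and>
        1-lipschitz_on {a..b} d \<and> mono_on {a..b} d \<and> mono_on {a..b} (\<lambda>t. t - d t) \<longrightarrow>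
        (\<exists>r p.
           costate D v a b d u p r \<and> minimum_principle D v a b d u p r \<and>
           (\<forall>\<alpha> \<beta>. a \<le> \<alpha> \<and> \<alpha> < \<beta> \<and> \<beta> \<le> b \<longrightarrow>
              (\<exists>\<alpha>' \<beta>'. \<alpha> \<le> \<alpha>' \<and> \<alpha>' < \<beta>' \<and> \<beta>' \<le> \<beta> \<and>
                 (constant_arc D v d u p \<alpha>' \<beta>' \<or> singular_arc D v d p \<alpha>' \<beta>' \<or>
                  full_slope_arc D v d u p \<alpha>' \<beta>'))) \<and>
           (\<forall>\<alpha> \<beta>. a \<le> \<alpha> \<and> \<alpha> < \<beta> \<and> \<beta> \<le> b \<longrightarrow>
              ((\<forall>t\<in>{\<alpha><..<\<beta>}. p t > logd2 D v t (t - d t)) \<longrightarrow>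
                 constant_arc D v d u p \<alpha> \<beta>) \<and>
              ((\<forall>t\<in>{\<alpha><..<\<beta>}. p t < logd2 D v t (t - d t)) \<longrightarrow>
                 full_slope_arc D v d u p \<alpha> \<beta>) \<and>
              ((AE t in lebesgue_on {\<alpha><..<\<beta>}. u t = 0) \<longrightarrow>
                 (\<forall>t\<in>{\<alpha>..\<beta>}. d t = d \<alpha>) \<and>
                 (\<forall>t\<in>{\<alpha><..<\<beta>}. p t = costate_constant D v d p r \<alpha> t \<and>
                    costate_constant D v d p r \<alpha> t \<ge> logd2 D v t (t - d \<alpha>))) \<and>
              (constant_arc D v d u p \<alpha> \<beta> \<longrightarrow>
                 (\<forall>t\<in>{\<alpha>..\<beta>}. d t = d \<alpha>) \<and>
                 (\<forall>t\<in>{\<alpha><..<\<beta>}. p t = costate_constant D v d p r \<alpha> t \<and>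
                    costate_constant D v d p r \<alpha> t > logd2 D v t (t - d \<alpha>))) \<and>
              (singular_arc D v d p \<alpha> \<beta> \<longrightarrow>
                 (\<forall>t\<in>{\<alpha>..\<beta>}. pd2 D v t (t - d t) = r)) \<and>
              ((AE t in lebesgue_on {\<alpha><..<\<beta>}. u t = 1) \<longrightarrow>
                 (\<forall>t\<in>{\<alpha>..\<beta>}. d t = d \<alpha> + (t - \<alpha>)) \<and>
                 (\<forall>t\<in>{\<alpha><..<\<beta>}. p t = costate_full_slope D v d p r \<alpha> t \<and>
                    costate_full_slope D v d p r \<alpha> t \<le> logd2 D v t (\<alpha> - d \<alpha>)))) \<and>
           min_hamiltonian D v b (d b) (area a d b) (p b) r = 0 \<and> p b = 0 \<and>
           area a d b = K))
     \<and>
     (\<forall>b d u.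
        optimal D v a d0 b d u \<and>
        1-lipschitz_on {a..b} d \<and> mono_on {a..b} d \<and> mono_on {a..b} (\<lambda>t. t - d t) \<longrightarrow>
        (\<exists>p.
           costate D v a b d u p 0 \<and> minimum_principle D v a b d u p 0 \<and>
           p b = 0 \<and> (a < b \<longrightarrow> min_hamiltonian D v b (d b) (area a d b) (p b) 0 = 0) \<and>
           (\<forall>\<alpha> \<beta>. a \<le> \<alpha> \<and> \<alpha> < \<beta> \<and> \<beta> \<le> b \<and> singular_arc D v d p \<alpha> \<beta> \<longrightarrow>
              (\<forall>t\<in>{\<alpha>..\<beta>}. pd2 D v t (t - d t) = 0))))"
proof -
  have hp: "half_plane D" using assms(6) by (simp add: half_plane_def)
  note pos = assms(8) and v = assms(9)
  show ?thesis
  proof (intro conjI allI impI)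
    fix b d u
    assume "area_optimal D v a d0 K b d u \<and>
        1-lipschitz_on {a..b} d \<and> mono_on {a..b} d \<and> mono_on {a..b} (\<lambda>t. t - d t)"
    then have opt: "area_optimal D v a d0 K b d u" by blast
    \<comment> \<open>The Hamiltonian at \<open>b\<close> is
      \<open>terminal_hamiltonian D v b d + r * d b\<close>; since \<open>d b > 0\<close>, this is
      the only \<open>r\<close> for which it is 0.\<close>
    let ?r = "- terminal_hamiltonian D v b d / d b"
    interpret extremal D v a b d u ?r
      by (rule extremal_area_optimal[OF hp v pos assms(4) opt])
    have "min_hamiltonian D v b (d b) (area a d b) (costate_path b) ?r = 0"
      unfolding min_hamiltonian_end using area_optimal_trajectory(5)[OF assms(4) opt] by simp
    moreover have "area a d b = K" using opt by (simp add: area_optimal_def)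
    ultimately show "\<exists>r p.
           costate D v a b d u p r \<and> minimum_principle D v a b d u p r \<and>
           (\<forall>\<alpha> \<beta>. a \<le> \<alpha> \<and> \<alpha> < \<beta> \<and> \<beta> \<le> b \<longrightarrow>
              (\<exists>\<alpha>' \<beta>'. \<alpha> \<le> \<alpha>' \<and> \<alpha>' < \<beta>' \<and> \<beta>' \<le> \<beta> \<and>
                 (constant_arc D v d u p \<alpha>' \<beta>' \<or> singular_arc D v d p \<alpha>' \<beta>' \<or>
                  full_slope_arc D v d u p \<alpha>' \<beta>'))) \<and>
           (\<forall>\<alpha> \<beta>. a \<le> \<alpha> \<and> \<alpha> < \<beta> \<and> \<beta> \<le> b \<longrightarrow>
              ((\<forall>t\<in>{\<alpha><..<\<beta>}. p t > logd2 D v t (t - d t)) \<longrightarrow>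
                 constant_arc D v d u p \<alpha> \<beta>) \<and>
              ((\<forall>t\<in>{\<alpha><..<\<beta>}. p t < logd2 D v t (t - d t)) \<longrightarrow>
                 full_slope_arc D v d u p \<alpha> \<beta>) \<and>
              ((AE t in lebesgue_on {\<alpha><..<\<beta>}. u t = 0) \<longrightarrow>
                 (\<forall>t\<in>{\<alpha>..\<beta>}. d t = d \<alpha>) \<and>
                 (\<forall>t\<in>{\<alpha><..<\<beta>}. p t = costate_constant D v d p r \<alpha> t \<and>
                    costate_constant D v d p r \<alpha> t \<ge> logd2 D v t (t - d \<alpha>))) \<and>
              (constant_arc D v d u p \<alpha> \<beta> \<longrightarrow>
                 (\<forall>t\<in>{\<alpha>..\<beta>}. d t = d \<alpha>) \<and>
                 (\<forall>t\<in>{\<alpha><..<\<beta>}. p t = costate_constant D v d p r \<alpha> t \<and>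
                    costate_constant D v d p r \<alpha> t > logd2 D v t (t - d \<alpha>))) \<and>
              (singular_arc D v d p \<alpha> \<beta> \<longrightarrow>
                 (\<forall>t\<in>{\<alpha>..\<beta>}. pd2 D v t (t - d t) = r)) \<and>
              ((AE t in lebesgue_on {\<alpha><..<\<beta>}. u t = 1) \<longrightarrow>
                 (\<forall>t\<in>{\<alpha>..\<beta>}. d t = d \<alpha> + (t - \<alpha>)) \<and>
                 (\<forall>t\<in>{\<alpha><..<\<beta>}. p t = costate_full_slope D v d p r \<alpha> t \<and>
                    costate_full_slope D v d p r \<alpha> t \<le> logd2 D v t (\<alpha> - d \<alpha>)))) \<and>
           min_hamiltonian D v b (d b) (area a d b) (p b) r = 0 \<and> p b = 0 \<and>
           area a d b = K"
      using arcs ex_arc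
      by (intro exI[of _ ?r] exI[of _ costate_path] conjI costate_costate_path
          minimum_principle_costate_path costate_path_end) blast+
  next
    fix b d u
    assume "optimal D v a d0 b d u \<and>
        1-lipschitz_on {a..b} d \<and> mono_on {a..b} d \<and> mono_on {a..b} (\<lambda>t. t - d t)"
    then have opt: "optimal D v a d0 b d u" by blast
    interpret extremal D v a b d u 0
      by (rule extremal_optimal[OF hp v pos opt])
    show "\<exists>p.
           costate D v a b d u p 0 \<and> minimum_principle D v a b d u p 0 \<and>
           p b = 0 \<and> (a < b \<longrightarrow> min_hamiltonian D v b (d b) (area a d b) (p b) 0 = 0) \<and>
           (\<forall>\<alpha> \<beta>. a \<le> \<alpha> \<and> \<alpha> < \<beta> \<and> \<beta> \<le> b \<and> singular_arc D v d p \<alpha> \<beta> \<longrightarrow>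
              (\<forall>t\<in>{\<alpha>..\<beta>}. pd2 D v t (t - d t) = 0))"
    proof (intro exI[of _ costate_path] conjI costate_costate_path minimum_principle_costate_path
        costate_path_end impI allI ballI)
      show "min_hamiltonian D v b (d b) (area a d b) (costate_path b) 0 = 0" if "a < b"
        unfolding min_hamiltonian_end using optimal_inequality(1)[OF hp v pos opt that] by simp
      show "pd2 D v t (t - d t) = 0"
        if "a \<le> \<alpha> \<and> \<alpha> < \<beta> \<and> \<beta> \<le> b \<and> singular_arc D v d costate_path \<alpha> \<beta>" "t \<in> {\<alpha>..\<beta>}" for \<alpha> \<beta> t
        by (rule structure_equation[of \<alpha> \<beta>]) (use that in \<open>auto simp: singular_arc_iff\<close>)
    qed
  qed
qed

end
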